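(* Let $\mathcal{C}$ denote the family of all bivariate copulas, endowed with the metric $D_1$. For every $C\in\mathcal{C}$ and every $r>0$ the closed ball $$\overline{B}(C,r):=\{A\in\mathcal{C}: D_1(A,C)\leq r\}$$ is not compact in $(\mathcal{C},D_1)$. In other words, $(\mathcal{C},D_1)$ is nowhere locally compact.
   Context: A bivariate copula is the restriction to $[0,1]^2$ of the distribution function of a probability measure on $[0,1]^2$ with both marginals equal to Lebesgue measure $\lambda$ on $[0,1]$. For a copula $C$, $\mu_C$ denotes the corresponding doubly stochastic measure, $\mu_C([0,x]\times[0,y])=C(x,y)$, and $K_C:[0,1]\times\mathcal{B}([0,1])\to[0,1]$ denotes (a version of) its Markov kernel: $x\mapsto K_C(x,E)$ is Borel measurable for each Borel set $E$, $K_C(x,\cdot)$ is a probability measure for each $x$, and $\mu_C(G)=\int_{[0,1]}K_C(x,G_x)\,d\lambda(x)$ for every $G\in\mathcal{B}([0,1]^2)$, where $G_x=\{y:(x,y)\in G\}$. The kernel is unique for $\lambda$-a.e. $x$. The metric $D_1$ on $\mathcal{C}$ is $$D_1(C_1,C_2)=\int_{[0,1]}\int_{[0,1]}\big|K_{C_1}(x,[0,y])-K_{C_2}(x,[0,y])\big|\,d\lambda(x)\,d\lambda(y).$$ Nowhere locally compact means that no point has a compact neighbourhood. *)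

theory Defs
  imports "HOL-Probability.Probability"
begin

definition unit_lborel :: "real measure" where
  "unit_lborel = restrict_space lborel {0..1}"

definition unit_square_borel :: "(real \<times> real) measure" where
  "unit_square_borel = restrict_space borel ({0..1} \<times> {0..1})"

definition doubly_stochastic :: "(real \<times> real) measure \<Rightarrow> bool" where
  "doubly_stochastic \<mu> \<longleftrightarrow>
     prob_space \<mu> \<and> sets \<mu> = sets unit_square_borel \<and>
     distr \<mu> unit_lborel fst = unit_lborel \<and> distr \<mu> unit_lborel snd = unit_lborel"

text \<open>
  A copula is a function on the unit square only. It is represented by an extensional function
  (constantly \<^const>\<open>undefined\<close> off the unit square), so that equality of representatives is
  equality of copulas.
\<close>

definition copula_of :: "(real \<times> real) measure \<Rightarrow> real \<times> real \<Rightarrow> real" where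
  "copula_of \<mu> = (\<lambda>(x, y) \<in> {0..1} \<times> {0..1}. measure \<mu> ({0..x} \<times> {0..y}))"

definition copulas :: "(real \<times> real \<Rightarrow> real) set" where
  "copulas = copula_of ` {\<mu>. doubly_stochastic \<mu>}"

definition copula_measure :: "(real \<times> real \<Rightarrow> real) \<Rightarrow> (real \<times> real) measure" where
  "copula_measure C = (THE \<mu>. doubly_stochastic \<mu> \<and> copula_of \<mu> = C)"

text \<open>
  Measurability into \<^const>\<open>prob_algebra\<close> says that every \<open>K x\<close> with \<open>x\<close> in \<open>[0,1]\<close> is a
  probability measure on the Borel sets of \<open>[0,1]\<close> and that \<open>x \<mapsto> K x E\<close> is Borel measurable
  for each Borel set \<open>E\<close>; \<open>Pair x -` G\<close> is the section of \<open>G\<close> at \<open>x\<close>.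
\<close>

definition is_markov_kernel_of ::
  "(real \<Rightarrow> real measure) \<Rightarrow> (real \<times> real) measure \<Rightarrow> bool" where
  "is_markov_kernel_of K \<mu> \<longleftrightarrow>
     K \<in> unit_lborel \<rightarrow>\<^sub>M prob_algebra unit_lborel \<and>
     (\<forall>G \<in> sets unit_square_borel.
        emeasure \<mu> G = (\<integral>\<^sup>+ x. emeasure (K x) (Pair x -` G) \<partial>unit_lborel))"

text \<open>
  A version of the kernel. It is determined only up to a null set of \<open>x\<close>, which does not
  affect \<open>D1\<close> below.
\<close>

definition copula_kernel :: "(real \<times> real \<Rightarrow> real) \<Rightarrow> real \<Rightarrow> real measure" where
  "copula_kernel C = (SOME K. is_markov_kernel_of K (copula_measure C))"

definition D1 :: "(real \<times> real \<Rightarrow> real) \<Rightarrow> (real \<times> real \<Rightarrow> real) \<Rightarrow> real" where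
  "D1 C\<^sub>1 C\<^sub>2 =
     (LINT y|unit_lborel. LINT x|unit_lborel.
        \<bar>measure (copula_kernel C\<^sub>1 x) {0..y} - measure (copula_kernel C\<^sub>2 x) {0..y}\<bar>)"

text \<open>
  The condition negated at each point is the one that \<^const>\<open>locally_compact_space\<close> requires
  of all points.
\<close>

definition nowhere_locally_compact_space :: "'a topology \<Rightarrow> bool" where
  "nowhere_locally_compact_space X \<longleftrightarrow>
     (\<forall>x \<in> topspace X. \<not> (\<exists>U K. openin X U \<and> compactin X K \<and> x \<in> U \<and> U \<subseteq> K))"

end

theory Submission
  imports Defs
begin

text \<open>
  Every ball around a copula \<open>C\<close> contains an infinite set of copulas with pairwise distances bounded
  below, so it is not contained in a compact set. The copulas are the mixtures
  \<open>(1 - e) C + e B\<^sub>k\<close>, where \<open>B\<^sub>k\<close> has the density \<open>1 + cos (2 \<pi> k x) cos (2 \<pi> y)\<close>. The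
  conditional distribution function of \<open>B\<^sub>k\<close> at height \<open>y\<close> is
  \<open>x \<mapsto> y + cos (2 \<pi> k x) sin (2 \<pi> y) / (2 \<pi>)\<close>. Since conditional distribution functions are affine in
  the measure, the mixture is at distance at most \<open>2 e\<close> from \<open>C\<close>, while the distance between two
  mixtures is \<open>e\<close> times the distance between the oscillating parts. The latter is bounded below by
  a constant because cosines of different frequencies are orthogonal
  (\<open>wave_L1_separated\<close>, \<open>separated_perturbations\<close>).

  For this to be an argument about a metric space, \<open>D1\<close> must be a metric on copulas
  (\<open>Metric_space_D1\<close>). It is defined through an arbitrarily chosen version of the Markov kernel,
  so kernels have to exist (\<open>markov_kernel_exists\<close>, a disintegration theorem for doubly stochastic
  measures) and the choice must not matter. Both points are reduced to one height \<open>y\<close> at a time: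
  \<open>x \<mapsto> K x {0..y}\<close> is a density of \<open>A \<mapsto> \<mu> (A \<times> {0..y})\<close> with respect to Lebesgue measure, hence
  unique almost everywhere and given by the Radon-Nikodym theorem. The distance only compares these
  densities (\<open>section_dist_conditional_cdf\<close>), so explicit formulas can be inserted for the mixtures
  without knowing their chosen kernels.
\<close>

section \<open>Lebesgue measure on the unit interval and Borel sets of the square\<close>

lemma space_unit_lborel [simp]: "space unit_lborel = {0..1}"
  by (simp add: unit_lborel_def space_restrict_space)

lemma sets_unit_lborel: "sets unit_lborel = sets (restrict_space borel {0..1})"
  by (simp add: unit_lborel_def sets_restrict_space)

lemma sets_unit_lborelI: "A \<in> sets borel \<Longrightarrow> A \<subseteq> {0..1} \<Longrightarrow> A \<in> sets unit_lborel"
  by (auto simp: sets_unit_lborel sets_restrict_space)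

lemma Icc_in_unit_lborel [simp]: "0 \<le> a \<Longrightarrow> b \<le> 1 \<Longrightarrow> {a..b} \<in> sets unit_lborel"
  by (rule sets_unit_lborelI) auto

lemma measurable_unit_lborelI [measurable (raw)]:
  "f \<in> borel_measurable borel \<Longrightarrow> f \<in> borel_measurable unit_lborel"
  unfolding unit_lborel_def by (intro measurable_restrict_space1) simp

lemma emeasure_unit_lborel: "A \<in> sets unit_lborel \<Longrightarrow> emeasure unit_lborel A = emeasure lborel A"
  by (auto simp: unit_lborel_def emeasure_restrict_space sets_restrict_space)

interpretation U: prob_space unit_lborel
  by (rule prob_spaceI) (simp add: emeasure_unit_lborel)

interpretation UU: pair_prob_space unit_lborel unit_lborel ..

lemma measure_unit_lborel_Icc [simp]:
  "0 \<le> a \<Longrightarrow> a \<le> b \<Longrightarrow> b \<le> 1 \<Longrightarrow> measure unit_lborel {a..b} = b - a"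
  by (simp add: measure_def emeasure_unit_lborel)

text \<open>
  The subspace \<open>\<sigma>\<close>-algebra of the square is the product \<open>\<sigma>\<close>-algebra: the identity is
  measurable in both directions. Everything below works with the product, for which rectangles
  and iterated integrals are available.
\<close>

lemma sets_unit_square_borel: "sets unit_square_borel = sets (unit_lborel \<Otimes>\<^sub>M unit_lborel)"
proof (rule subset_antisym)
  have sp: "space unit_square_borel = space (unit_lborel \<Otimes>\<^sub>M unit_lborel)"
    by (simp add: unit_square_borel_def space_restrict_space space_pair_measure)
  have "(\<lambda>z. z) \<in> unit_lborel \<Otimes>\<^sub>M unit_lborel \<rightarrow>\<^sub>M unit_square_borel"
    unfolding unit_square_borel_def borel_prod[symmetric]
  proof (rule measurable_restrict_space2)
    have id: "(\<lambda>x. x) \<in> borel_measurable unit_lborel" by measurable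
    show "(\<lambda>z. z) \<in> unit_lborel \<Otimes>\<^sub>M unit_lborel \<rightarrow>\<^sub>M borel \<Otimes>\<^sub>M borel"
      using measurable_Pair[OF measurable_compose[OF measurable_fst id] measurable_compose[OF measurable_snd id]]
      by simp
  qed (auto simp: space_pair_measure)
  then show "sets unit_square_borel \<subseteq> sets (unit_lborel \<Otimes>\<^sub>M unit_lborel)"
    using sets.sets_into_space[of _ unit_square_borel] sp by (fastforce dest: measurable_sets simp: Int_absorb2)
  have p: "fst \<in> unit_square_borel \<rightarrow>\<^sub>M unit_lborel" "snd \<in> unit_square_borel \<rightarrow>\<^sub>M unit_lborel"
    unfolding unit_square_borel_def unit_lborel_def
    by (auto intro!: measurable_restrict_space3 simp: borel_prod[symmetric])
  have "(\<lambda>z. (fst z, snd z)) \<in> unit_square_borel \<rightarrow>\<^sub>M unit_lborel \<Otimes>\<^sub>M unit_lborel"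
    by (rule measurable_Pair) (use p in simp_all)
  then show "sets (unit_lborel \<Otimes>\<^sub>M unit_lborel) \<subseteq> sets unit_square_borel"
    using sets.sets_into_space[of _ "unit_lborel \<Otimes>\<^sub>M unit_lborel"] sp
    by (fastforce dest: measurable_sets simp: Int_absorb2)
qed

text \<open>
  The lower left quadrants form an intersection-stable generator of the Borel sets of the plane,
  and on the square they cut out the corner rectangles that a copula records, or nothing. The argument
  passes to the plane because \<open>borel_eq_atMost\<close> describes the generator there.
\<close>

lemma measure_eq_on_square:
  assumes s: "sets \<mu> = sets unit_square_borel" "sets \<nu> = sets unit_square_borel"
    and f: "finite_measure \<mu>" "finite_measure \<nu>"
    and eq: "\<And>x y. x \<in> {0..1} \<Longrightarrow> y \<in> {0..1} \<Longrightarrow>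
               measure \<mu> ({0..x} \<times> {0..y}) = measure \<nu> ({0..x} \<times> {0..y})"
  shows "\<mu> = \<nu>"
proof -
  define D where "D M = distr M borel (\<lambda>z::real\<times>real. z)" for M
  interpret m: finite_measure \<mu> by fact
  interpret n: finite_measure \<nu> by fact
  have sp: "space \<mu> = {0..1} \<times> {0..1}" "space \<nu> = {0..1} \<times> {0..1}"
    using s[THEN sets_eq_imp_space_eq] by (auto simp: unit_square_borel_def space_restrict_space)
  have id: "(\<lambda>z. z) \<in> borel_measurable M" if "sets M = sets unit_square_borel" for M :: "(real \<times> real) measure"
    unfolding measurable_cong_sets[OF that refl] unit_square_borel_def by (rule measurable_restrict_space1) simp
  have em: "emeasure (D M) A = emeasure M (A \<inter> space M)"
    if "sets M = sets unit_square_borel" "A \<in> sets borel" for M A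
    unfolding D_def by (subst emeasure_distr[OF id]) (use that in auto)
  have "D \<mu> = D \<nu>"
  proof (rule measure_eqI_generator_eq)
    let ?E = "range (\<lambda>a::real\<times>real. {..a})"
    show "Int_stable ?E"
    proof (rule Int_stableI)
      fix A B assume "A \<in> ?E" "B \<in> ?E"
      then obtain a b where "A = {..a}" "B = {..b}" by auto
      moreover have "{..a} \<inter> {..b} = {..inf a b}" by auto
      ultimately show "A \<inter> B \<in> ?E" by auto
    qed
    show "sets (D \<mu>) = sigma_sets UNIV ?E" "sets (D \<nu>) = sigma_sets UNIV ?E"
      by (simp_all add: D_def borel_eq_atMost)
    show "range (\<lambda>i. {..(real i, real i)}) \<subseteq> ?E" by auto
    show "(\<Union>i. {..(real i, real i)}) = UNIV"
    proof -
      have "\<exists>i. a \<le> real i \<and> b \<le> real i" for a b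
        by (meson nle_le order_trans real_arch_simple)
      then show ?thesis by (auto simp: less_eq_prod_def)
    qed
    show "emeasure (D \<mu>) {..(real i, real i)} \<noteq> \<infinity>" for i
      by (subst em[OF s(1)]) auto
  next
    fix X assume "X \<in> range (\<lambda>a::real\<times>real. {..a})"
    then obtain x y where X: "X = {..(x, y)}" by auto
    have "X \<inter> {0..1} \<times> {0..1} =
      (if 0 \<le> x \<and> 0 \<le> y then {0..min x 1} \<times> {0..min y 1} else {})"
      by (auto simp: X less_eq_prod_def)
    then have "emeasure \<mu> (X \<inter> space \<mu>) = emeasure \<nu> (X \<inter> space \<nu>)"
      unfolding sp using eq[of "min x 1" "min y 1"] by (simp add: m.emeasure_eq_measure n.emeasure_eq_measure)
    then show "emeasure (D \<mu>) X = emeasure (D \<nu>) X"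
      by (simp add: em s X)
  qed auto
  moreover have "emeasure M A = emeasure (D M) A" if "sets M = sets unit_square_borel" "A \<in> sets M" for M A
  proof -
    have "({0..1} \<times> {0..1} :: (real \<times> real) set) \<in> sets borel" by (intro borel_closed closed_Times) auto
    with that have "A \<in> sets borel" by (auto simp: unit_square_borel_def sets_restrict_space)
    with that show ?thesis using sets.sets_into_space[OF that(2)] by (simp add: em Int_absorb2)
  qed
  ultimately show ?thesis
    using s by (intro measure_eqI) auto
qed

lemma copula_measure_copula_of:
  assumes "doubly_stochastic \<mu>"
  shows "copula_measure (copula_of \<mu>) = \<mu>"
  unfolding copula_measure_def
proof (rule the_equality)
  fix \<nu> assume \<nu>: "doubly_stochastic \<nu> \<and> copula_of \<nu> = copula_of \<mu>"
  show "\<nu> = \<mu>"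
  proof (rule measure_eq_on_square)
    fix x y :: real assume "x \<in> {0..1}" "y \<in> {0..1}"
    moreover have "copula_of \<nu> (x,y) = copula_of \<mu> (x,y)" using \<nu> by simp
    ultimately show "measure \<nu> ({0..x} \<times> {0..y}) = measure \<mu> ({0..x} \<times> {0..y})"
      by (simp add: copula_of_def)
  qed (use assms \<nu> in \<open>auto simp: doubly_stochastic_def prob_space_def\<close>)
qed (use assms in simp)

section \<open>Doubly stochastic measures\<close>

lemma doubly_stochastic_prob_space: "doubly_stochastic \<mu> \<Longrightarrow> prob_space \<mu>"
  by (simp add: doubly_stochastic_def)

lemma doubly_stochastic_sets:
  "doubly_stochastic \<mu> \<Longrightarrow> sets \<mu> = sets (unit_lborel \<Otimes>\<^sub>M unit_lborel)"
  by (simp add: doubly_stochastic_def sets_unit_square_borel)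

lemma doubly_stochastic_space: "doubly_stochastic \<mu> \<Longrightarrow> space \<mu> = {0..1} \<times> {0..1}"
  using sets_eq_imp_space_eq[OF doubly_stochastic_sets, of \<mu>] by (simp add: space_pair_measure)

lemma rectangle_in_doubly_stochastic:
  "doubly_stochastic \<mu> \<Longrightarrow> A \<in> sets unit_lborel \<Longrightarrow> B \<in> sets unit_lborel \<Longrightarrow> A \<times> B \<in> sets \<mu>"
  by (simp add: doubly_stochastic_sets)

lemma sets_unit_lborel_subset: "A \<in> sets unit_lborel \<Longrightarrow> A \<subseteq> {0..1}"
  using sets.sets_into_space[of A unit_lborel] by simp

lemma measurable_doubly_stochastic:
  "doubly_stochastic \<mu> \<Longrightarrow> f \<in> unit_lborel \<Otimes>\<^sub>M unit_lborel \<rightarrow>\<^sub>M M \<Longrightarrow> f \<in> \<mu> \<rightarrow>\<^sub>M M"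
  using measurable_cong_sets[OF doubly_stochastic_sets refl] by blast

lemma doubly_stochastic_marginal_fst:
  assumes "doubly_stochastic \<mu>" "A \<in> sets unit_lborel"
  shows "measure \<mu> (A \<times> {0..1}) = measure unit_lborel A"
proof -
  have "measure unit_lborel A = measure (distr \<mu> unit_lborel fst) A"
    using assms by (simp add: doubly_stochastic_def)
  also have "\<dots> = measure \<mu> (fst -` A \<inter> space \<mu>)"
    by (rule measure_distr[OF measurable_doubly_stochastic[OF assms(1) measurable_fst] assms(2)])
  also have "fst -` A \<inter> space \<mu> = A \<times> {0..1}"
    using sets_unit_lborel_subset[OF assms(2)] by (auto simp: doubly_stochastic_space[OF assms(1)])
  finally show ?thesis ..
qed

lemma doubly_stochastic_marginal_snd:
  assumes "doubly_stochastic \<mu>" "B \<in> sets unit_lborel"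
  shows "measure \<mu> ({0..1} \<times> B) = measure unit_lborel B"
proof -
  have "measure unit_lborel B = measure (distr \<mu> unit_lborel snd) B"
    using assms by (simp add: doubly_stochastic_def)
  also have "\<dots> = measure \<mu> (snd -` B \<inter> space \<mu>)"
    by (rule measure_distr[OF measurable_doubly_stochastic[OF assms(1) measurable_snd] assms(2)])
  also have "snd -` B \<inter> space \<mu> = {0..1} \<times> B"
    using sets_unit_lborel_subset[OF assms(2)] by (auto simp: doubly_stochastic_space[OF assms(1)])
  finally show ?thesis ..
qed

lemma doubly_stochastic_strip_mono:
  assumes "doubly_stochastic \<mu>" "A \<in> sets unit_lborel" "0 \<le> y" "y \<le> y'" "y' \<le> 1"
  shows "measure \<mu> (A \<times> {0..y}) \<le> measure \<mu> (A \<times> {0..y'})"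
proof -
  interpret prob_space \<mu> by (rule doubly_stochastic_prob_space) fact
  show ?thesis
    by (rule finite_measure_mono) (use assms in \<open>auto intro!: rectangle_in_doubly_stochastic\<close>)
qed

text \<open>
  The horizontal strip between heights \<open>y\<close> and \<open>y'\<close> has mass \<open>y' - y\<close>, whatever the
  measure. This continuity in \<open>y\<close> lets statements about a dense set of heights extend to all
  of them, both for the rational heights in the construction of kernels and for the almost all
  heights provided by a vanishing distance.
\<close>

lemma doubly_stochastic_strip_Lipschitz:
  assumes "doubly_stochastic \<mu>" "A \<in> sets unit_lborel" "0 \<le> y" "y \<le> y'" "y' \<le> 1"
  shows "measure \<mu> (A \<times> {0..y'}) \<le> measure \<mu> (A \<times> {0..y}) + (y' - y)"
proof -
  interpret prob_space \<mu> by (rule doubly_stochastic_prob_space) fact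
  have r: "A \<times> {0..y} \<in> sets \<mu>" "{0..1} \<times> {y..y'} \<in> sets \<mu>"
    using assms by (auto intro!: rectangle_in_doubly_stochastic)
  have "measure \<mu> (A \<times> {0..y'}) \<le> measure \<mu> (A \<times> {0..y} \<union> {0..1} \<times> {y..y'})"
    using r sets_unit_lborel_subset[OF assms(2)] by (intro finite_measure_mono) auto
  also have "\<dots> \<le> measure \<mu> (A \<times> {0..y}) + measure \<mu> ({0..1} \<times> {y..y'})"
    using r by (rule measure_Un_le)
  also have "measure \<mu> ({0..1} \<times> {y..y'}) = y' - y"
    using assms by (subst doubly_stochastic_marginal_snd) auto
  finally show ?thesis .
qed

section \<open>Conditional distribution functions\<close>

text \<open>
  Integrate over the set where \<open>g < f\<close>: there \<open>f - g\<close> is positive but has integral at most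
  zero.
\<close>

lemma AE_le_if_integrals_le:
  fixes f g :: "'a \<Rightarrow> real"
  assumes [measurable]: "integrable M f" "integrable M g"
    and le: "\<And>A. A \<in> sets M \<Longrightarrow> (\<integral>x. f x * indicator A x \<partial>M) \<le> (\<integral>x. g x * indicator A x \<partial>M)"
  shows "AE x in M. f x \<le> g x"
proof -
  define A where "A = {x \<in> space M. g x < f x}"
  have [measurable]: "A \<in> sets M" unfolding A_def by measurable
  have i: "integrable M (\<lambda>x. f x * indicator A x)" "integrable M (\<lambda>x. g x * indicator A x)"
    using assms by (auto intro: integrable_real_mult_indicator)
  have nn: "0 \<le> f x * indicator A x - g x * indicator A x" for x
    by (auto simp: A_def indicator_def)
  have "(\<integral>x. f x * indicator A x - g x * indicator A x \<partial>M) \<le> 0"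
    using le[of A] i by simp
  then have "(\<integral>x. f x * indicator A x - g x * indicator A x \<partial>M) = 0"
    using nn by (intro antisym integral_nonneg_AE) auto
  then have "AE x in M. f x * indicator A x - g x * indicator A x = 0"
    using i nn by (subst integral_nonneg_eq_0_iff_AE[symmetric]) auto
  then show ?thesis
    using AE_space by eventually_elim (auto simp: A_def indicator_def split: if_splits)
qed

text \<open>
  The function \<open>g\<close> is a version of \<open>x \<mapsto> K x {0..y}\<close>, described without a kernel: it is a
  density of the measure \<open>A \<mapsto> \<mu> (A \<times> {0..y})\<close> with respect to Lebesgue measure. In this form
  uniqueness almost everywhere, monotonicity in \<open>y\<close> and linearity in \<open>\<mu>\<close> are facts about
  integrals over sets. Integrability replaces the bounds \<open>0 \<le> g \<le> 1\<close>, so that explicit formulas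
  qualify without a pointwise estimate.
\<close>

definition conditional_cdf :: "(real \<times> real) measure \<Rightarrow> real \<Rightarrow> (real \<Rightarrow> real) \<Rightarrow> bool" where
  "conditional_cdf \<mu> y g \<longleftrightarrow> integrable unit_lborel g \<and>
     (\<forall>A\<in>sets unit_lborel. measure \<mu> (A \<times> {0..y}) = (\<integral>x. g x * indicator A x \<partial>unit_lborel))"

lemma conditional_cdf_mono:
  assumes "doubly_stochastic \<mu>" "conditional_cdf \<mu> y g" "conditional_cdf \<mu> y' g'"
    "0 \<le> y" "y \<le> y'" "y' \<le> 1"
  shows "AE x in unit_lborel. g x \<le> g' x"
  using assms doubly_stochastic_strip_mono[of \<mu> _ y y']
  by (intro AE_le_if_integrals_le) (auto simp: conditional_cdf_def)

lemma conditional_cdf_unique: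
  assumes "conditional_cdf \<mu> y g" "conditional_cdf \<mu> y g'"
  shows "AE x in unit_lborel. g x = g' x"
proof -
  have "AE x in unit_lborel. g x \<le> g' x" "AE x in unit_lborel. g' x \<le> g x"
    using assms by (auto intro!: AE_le_if_integrals_le simp: conditional_cdf_def)
  then show ?thesis by eventually_elim auto
qed

text \<open>
  A Radon-Nikodym derivative. The measure \<open>A \<mapsto> \<mu> (A \<times> {0..y})\<close> is bounded by the first marginal,
  that is by Lebesgue measure; hence it is absolutely continuous and its derivative is at most 1
  almost everywhere. Truncating at 1 makes the bound hold everywhere.
\<close>

lemma conditional_cdf_exists:
  assumes ds: "doubly_stochastic \<mu>" and y: "0 \<le> y" "y \<le> 1"
  shows "\<exists>g. conditional_cdf \<mu> y g \<and> (\<forall>x. 0 \<le> g x \<and> g x \<le> 1)"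
proof -
  interpret prob_space \<mu> by (rule doubly_stochastic_prob_space) fact
  define N where "N = distr (density \<mu> (indicator ({0..1} \<times> {0..y}))) unit_lborel fst"
  have rect: "A \<times> {0..y} \<in> sets \<mu>" if "A \<in> sets unit_lborel" for A
    using ds that y by (auto intro: rectangle_in_doubly_stochastic)
  have f: "fst \<in> density \<mu> (indicator ({0..1} \<times> {0..y})) \<rightarrow>\<^sub>M unit_lborel"
    using measurable_doubly_stochastic[OF ds measurable_fst] by simp
  have emN: "emeasure N A = emeasure \<mu> (A \<times> {0..y})" if A: "A \<in> sets unit_lborel" for A
  proof -
    have [measurable]: "A \<times> {0..1} \<in> sets \<mu>" "{0..1} \<times> {0..y} \<in> sets \<mu>"
      using A rect[of "{0..1}"] ds by (auto intro: rectangle_in_doubly_stochastic)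
    have "emeasure N A = emeasure (density \<mu> (indicator ({0..1} \<times> {0..y}))) (fst -` A \<inter> space \<mu>)"
      unfolding N_def by (subst emeasure_distr[OF f]) (use A in auto)
    also have "fst -` A \<inter> space \<mu> = A \<times> {0..1}"
      using sets_unit_lborel_subset[OF A] by (auto simp: doubly_stochastic_space[OF ds])
    also have "emeasure (density \<mu> (indicator ({0..1} \<times> {0..y}))) (A \<times> {0..1}) =
      (\<integral>\<^sup>+z. indicator (({0..1} \<times> {0..y}) \<inter> (A \<times> {0..1})) z \<partial>\<mu>)"
      by (subst emeasure_density) (auto intro!: nn_integral_cong simp del: nn_integral_indicator simp: indicator_def)
    also have "({0..1} \<times> {0..y}) \<inter> (A \<times> {0..1}) = A \<times> {0..y}"
      using sets_unit_lborel_subset[OF A] y by auto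
    finally show ?thesis using rect[OF A] by simp
  qed
  have sN: "sets N = sets unit_lborel" by (simp add: N_def)
  have "absolutely_continuous unit_lborel N"
  proof (unfold absolutely_continuous_def null_sets_def, safe)
    fix A assume A: "A \<in> sets unit_lborel" "emeasure unit_lborel A = 0"
    have "measure \<mu> (A \<times> {0..y}) \<le> measure \<mu> (A \<times> {0..1})"
      using doubly_stochastic_strip_mono[OF ds A(1), of y 1] y by simp
    also have "\<dots> = 0" using A doubly_stochastic_marginal_fst[OF ds A(1)] by (simp add: measure_def)
    finally have "measure \<mu> (A \<times> {0..y}) = 0" using measure_nonneg[of \<mu> "A \<times> {0..y}"] by linarith
    then show "emeasure N A = 0" by (simp add: emN A emeasure_eq_measure)
  qed (simp add: sN)
  then have RN: "density unit_lborel (RN_deriv unit_lborel N) = N"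
    by (rule U.density_RN_deriv) (rule sN)
  define h where "h x = enn2real (RN_deriv unit_lborel N x)" for x
  have [measurable]: "h \<in> borel_measurable unit_lborel" unfolding h_def by measurable
  have nnN: "(\<integral>\<^sup>+x. RN_deriv unit_lborel N x * indicator A x \<partial>unit_lborel) = emeasure N A"
    if "A \<in> sets unit_lborel" for A
    by (subst (2) RN[symmetric]) (use that in \<open>simp add: emeasure_density\<close>)
  have "(\<integral>\<^sup>+x. RN_deriv unit_lborel N x \<partial>unit_lborel) = emeasure N {0..1}"
    using nnN[of "{0..1}"] nn_integral_cong[of unit_lborel "\<lambda>x. RN_deriv unit_lborel N x * indicator {0..1} x" "RN_deriv unit_lborel N"]
    by simp
  also have "\<dots> < \<infinity>" by (simp add: emN emeasure_eq_measure)
  finally have fin: "(\<integral>\<^sup>+x. RN_deriv unit_lborel N x \<partial>unit_lborel) \<noteq> \<infinity>" by simp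
  then have "AE x in unit_lborel. RN_deriv unit_lborel N x \<noteq> \<infinity>"
    by (intro nn_integral_PInf_AE) auto
  then have hRN: "AE x in unit_lborel. ennreal (h x) = RN_deriv unit_lborel N x"
    by eventually_elim (simp add: h_def ennreal_enn2real_if)
  have ih: "integrable unit_lborel h"
  proof (rule integrableI_nonneg)
    have "(\<integral>\<^sup>+x. ennreal (h x) \<partial>unit_lborel) = (\<integral>\<^sup>+x. RN_deriv unit_lborel N x \<partial>unit_lborel)"
      using hRN by (rule nn_integral_cong_AE)
    then show "(\<integral>\<^sup>+x. ennreal (h x) \<partial>unit_lborel) < \<infinity>" using fin by (simp add: less_top)
  qed (auto simp: h_def)
  have hint: "measure \<mu> (A \<times> {0..y}) = (\<integral>x. h x * indicator A x \<partial>unit_lborel)"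
    if A[measurable]: "A \<in> sets unit_lborel" for A
  proof -
    have "ennreal (measure \<mu> (A \<times> {0..y})) = emeasure N A" using A by (simp add: emN emeasure_eq_measure)
    also have "\<dots> = (\<integral>\<^sup>+x. RN_deriv unit_lborel N x * indicator A x \<partial>unit_lborel)" using A by (simp add: nnN)
    also have "\<dots> = (\<integral>\<^sup>+x. ennreal (h x * indicator A x) \<partial>unit_lborel)"
      by (rule nn_integral_cong_AE) (use hRN in eventually_elim, auto simp: indicator_def)
    also have "\<dots> = ennreal (\<integral>x. h x * indicator A x \<partial>unit_lborel)"
      by (rule nn_integral_eq_integral) (use integrable_real_mult_indicator[OF A ih] in \<open>simp_all add: h_def\<close>)
    finally show ?thesis
      by (subst (asm) ennreal_inj) (auto simp: h_def intro!: integral_nonneg_AE)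
  qed
  have h1: "AE x in unit_lborel. h x \<le> 1"
  proof (rule AE_le_if_integrals_le)
    fix A assume A: "A \<in> sets unit_lborel"
    have "measure \<mu> (A \<times> {0..y}) \<le> measure \<mu> (A \<times> {0..1})"
      using doubly_stochastic_strip_mono[OF ds A(1), of y 1] y by simp
    then show "(\<integral>x. h x * indicator A x \<partial>unit_lborel) \<le> (\<integral>x. 1 * indicator A x \<partial>unit_lborel)"
      using A sets_unit_lborel_subset[OF A] by (simp add: hint doubly_stochastic_marginal_fst[OF ds A] Int_absorb2)
  qed (use ih in auto)
  show ?thesis
  proof (intro exI[of _ "\<lambda>x. min 1 (h x)"] conjI)
    show "conditional_cdf \<mu> y (\<lambda>x. min 1 (h x))"
      unfolding conditional_cdf_def
    proof (intro conjI ballI)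
      show "integrable unit_lborel (\<lambda>x. min 1 (h x))" using ih by (intro integrable_min) auto
      fix A assume A: "A \<in> sets unit_lborel"
      then have [measurable]: "A \<in> sets unit_lborel" .
      show "measure \<mu> (A \<times> {0..y}) = (\<integral>x. min 1 (h x) * indicator A x \<partial>unit_lborel)"
        unfolding hint[OF A]
      proof (rule integral_cong_AE)
        show "AE x in unit_lborel. h x * indicator A x = min 1 (h x) * indicator A x"
          using h1 by eventually_elim (auto simp: min_def)
      qed measurable
    qed
  qed (auto simp: h_def)
qed

section \<open>Existence of Markov kernels\<close>

abbreviation clamp_unit :: "real \<Rightarrow> real" where
  "clamp_unit y \<equiv> max 0 (min 1 y)"

lemma measurable_clamp_unit: "clamp_unit \<in> borel \<rightarrow>\<^sub>M unit_lborel"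
proof -
  have "clamp_unit \<in> borel \<rightarrow>\<^sub>M restrict_space borel {0..1}"
    by (rule measurable_restrict_space2) auto
  then show ?thesis
    using measurable_cong_sets[OF refl sets_unit_lborel, of borel] by blast
qed

text \<open>
  A measurable family of distribution functions gives a measurable family of measures, since
  measurability may be tested on the half-lines. The measures live on the line first; pushing them
  forward along the clamp gives measures on the unit interval without moving any mass.
\<close>

lemma kernel_from_cdf:
  fixes G :: "real \<Rightarrow> real \<Rightarrow> real"
  assumes meas: "\<And>y. (\<lambda>x. G x y) \<in> borel_measurable unit_lborel"
    and mono: "\<And>x y y'. y \<le> y' \<Longrightarrow> G x y \<le> G x y'"
    and right_cont: "\<And>x y. continuous (at_right y) (G x)"
    and zero: "\<And>x y. y < 0 \<Longrightarrow> G x y = 0"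
    and one: "\<And>x y. 1 \<le> y \<Longrightarrow> G x y = 1"
  shows "\<exists>K. K \<in> unit_lborel \<rightarrow>\<^sub>M prob_algebra unit_lborel \<and>
             (\<forall>x y. 0 \<le> y \<longrightarrow> y \<le> 1 \<longrightarrow> measure (K x) {0..y} = G x y)"
proof -
  have bot: "(G x \<longlongrightarrow> 0) at_bot" for x
    by (rule tendsto_eventually) (auto simp: eventually_at_bot_linorder zero intro!: exI[of _ "-1"])
  have top: "(G x \<longlongrightarrow> 1) at_top" for x
    by (rule tendsto_eventually) (auto simp: eventually_at_top_linorder one intro!: exI[of _ 1])
  define M where "M x = interval_measure (G x)" for x
  have distrM: "real_distribution (M x)" for x
    unfolding M_def using mono right_cont bot top by (rule real_distribution_interval_measure)
  have cdfM: "measure (M x) {..y} = G x y" for x y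
    unfolding M_def using mono right_cont bot by (rule measure_interval_measure_Iic)
  have M: "M \<in> unit_lborel \<rightarrow>\<^sub>M prob_algebra borel"
  proof (rule measurable_prob_algebra_generated[where \<Omega>=UNIV and G="range (\<lambda>a::real. {..a})"])
    show "sets borel = sigma_sets UNIV (range (\<lambda>a::real. {..a}))" by (simp add: borel_eq_atMost)
    show "Int_stable (range (\<lambda>a::real. {..a}))"
      by (auto simp: Int_stable_def intro!: image_eqI[of _ _ "min _ _"])
    show "prob_space (M x)" for x using distrM by (simp add: real_distribution_def)
    show "sets (M x) = sets borel" for x by (simp add: M_def)
    fix A assume "A \<in> range (\<lambda>a::real. {..a})"
    then obtain a where A: "A = {..a}" by auto
    have "emeasure (M x) A = ennreal (G x a)" for x
    proof -
      interpret real_distribution "M x" by (rule distrM)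
      show ?thesis by (simp add: A emeasure_eq_measure cdfM)
    qed
    then show "(\<lambda>x. emeasure (M x) A) \<in> borel_measurable unit_lborel" using meas[of a] by simp
  qed auto
  show ?thesis
  proof (intro exI[of _ "\<lambda>x. distr (M x) unit_lborel clamp_unit"] conjI allI impI)
    show "(\<lambda>x. distr (M x) unit_lborel clamp_unit) \<in> unit_lborel \<rightarrow>\<^sub>M prob_algebra unit_lborel"
      using M measurable_distr_prob_space[OF measurable_clamp_unit] by (rule measurable_compose)
    fix x y :: real assume y: "0 \<le> y" "y \<le> 1"
    interpret real_distribution "M x" by (rule distrM)
    have c: "clamp_unit \<in> M x \<rightarrow>\<^sub>M unit_lborel"
      using measurable_clamp_unit by (simp cong: measurable_cong_sets)
    have "measure (distr (M x) unit_lborel clamp_unit) {0..y} = measure (M x) (clamp_unit -` {0..y} \<inter> space (M x))"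
      by (rule measure_distr[OF c]) (use y in simp)
    also have "\<dots> = G x y"
    proof (cases "y = 1")
      case True
      have "clamp_unit -` {0..1} = UNIV" by (auto simp: max_def min_def)
      then show ?thesis using True prob_space by (simp add: one)
    next
      case False
      then have "clamp_unit -` {0..y} \<inter> space (M x) = {..y}" using y by auto
      then show ?thesis by (simp add: cdfM)
    qed
    finally show "measure (distr (M x) unit_lborel clamp_unit) {0..y} = G x y" .
  qed
qed

text \<open>
  The kernel composed with Lebesgue measure, written as a bind in the Giry monad, is a measure on the
  square whose values on corner rectangles are those of \<open>\<mu>\<close>; hence it is \<open>\<mu>\<close>, and the identity
  required of a kernel holds for all Borel sets at once.
\<close>

lemma is_markov_kernel_ofI:
  assumes ds: "doubly_stochastic \<mu>"
    and K: "K \<in> unit_lborel \<rightarrow>\<^sub>M prob_algebra unit_lborel"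
    and cdf: "\<And>y. 0 \<le> y \<Longrightarrow> y \<le> 1 \<Longrightarrow> conditional_cdf \<mu> y (\<lambda>x. measure (K x) {0..y})"
  shows "is_markov_kernel_of K \<mu>"
proof -
  let ?S = "unit_lborel \<Otimes>\<^sub>M unit_lborel"
  let ?k = "\<lambda>x. distr (K x) ?S (Pair x)"
  define \<nu> where "\<nu> = unit_lborel \<bind> ?k"
  have Kx: "sets (K x) = sets unit_lborel" "prob_space (K x)" if "x \<in> {0..1}" for x
    using measurable_space[OF K, of x] that by (auto simp: space_prob_algebra)
  have k: "?k \<in> unit_lborel \<rightarrow>\<^sub>M prob_algebra ?S"
    using K by measurable
  have U: "unit_lborel \<in> space (prob_algebra unit_lborel)"
    by (simp add: space_prob_algebra U.prob_space_axioms)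
  have em: "emeasure \<nu> G = (\<integral>\<^sup>+x. emeasure (K x) (Pair x -` G) \<partial>unit_lborel)" if G: "G \<in> sets ?S" for G
    unfolding \<nu>_def emeasure_bind_prob_algebra[OF U k G]
  proof (rule nn_integral_cong)
    fix x assume "x \<in> space unit_lborel"
    then have x: "x \<in> {0..1}" by simp
    have "Pair x \<in> unit_lborel \<rightarrow>\<^sub>M ?S" using x by (intro measurable_Pair1') simp
    then have P: "Pair x \<in> K x \<rightarrow>\<^sub>M ?S" using measurable_cong_sets[OF Kx(1)[OF x] refl] by blast
    have "Pair x -` G \<subseteq> space (K x)"
      using sets_eq_imp_space_eq[OF Kx(1)[OF x]] sets.sets_into_space[OF G] by (auto simp: space_pair_measure)
    then show "emeasure (?k x) G = emeasure (K x) (Pair x -` G)"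
      using emeasure_distr[OF P G] by (simp add: Int_absorb2)
  qed
  have sets: "sets \<nu> = sets ?S" unfolding \<nu>_def by (rule sets_bind'[OF U k])
  have "prob_space \<nu>" unfolding \<nu>_def by (rule prob_space_bind'[OF U k])
  interpret m: prob_space \<mu> using ds by (rule doubly_stochastic_prob_space)
  have "\<mu> = \<nu>"
  proof (rule measure_eq_on_square)
    fix a b :: real assume a: "a \<in> {0..1}" and b: "b \<in> {0..1}"
    have R: "{0..a} \<times> {0..b} \<in> sets ?S" using a b by auto
    have "emeasure \<nu> ({0..a} \<times> {0..b}) = (\<integral>\<^sup>+x. ennreal (measure (K x) {0..b} * indicator {0..a} x) \<partial>unit_lborel)"
      unfolding em[OF R]
    proof (rule nn_integral_cong)
      fix x assume "x \<in> space unit_lborel"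
      then interpret prob_space "K x" using Kx by simp
      show "emeasure (K x) (Pair x -` ({0..a} \<times> {0..b})) = ennreal (measure (K x) {0..b} * indicator {0..a} x)"
        by (simp add: Pair_vimage_Sigma indicator_def emeasure_eq_measure)
    qed
    also have "\<dots> = ennreal (\<integral>x. measure (K x) {0..b} * indicator {0..a} x \<partial>unit_lborel)"
      using cdf[of b] a b by (intro nn_integral_eq_integral) (auto simp: conditional_cdf_def intro: integrable_real_mult_indicator)
    also have "\<dots> = ennreal (measure \<mu> ({0..a} \<times> {0..b}))"
      using cdf[of b] a b by (simp add: conditional_cdf_def)
    finally show "measure \<mu> ({0..a} \<times> {0..b}) = measure \<nu> ({0..a} \<times> {0..b})"
      by (simp add: measure_def)
  qed (use ds sets \<open>prob_space \<nu>\<close> in \<open>auto simp: prob_space_def doubly_stochastic_def sets_unit_square_borel\<close>)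
  then show ?thesis
    using em K by (simp add: is_markov_kernel_of_def sets_unit_square_borel)
qed

text \<open>
  Disintegration. The densities \<open>f q\<close> for rational heights \<open>q\<close> are each determined only almost
  everywhere, and for a given \<open>x\<close> they need not increase with \<open>q\<close>. The infimum over rational
  heights above \<open>y\<close> is increasing and right-continuous in \<open>y\<close> for every \<open>x\<close>, so no exceptional
  set has to be repaired. Monotonicity of the \<open>f q\<close> almost everywhere then shows that the infimum
  has the correct integrals: it lies between the densities at rational heights below and above
  \<open>y\<close>, whose integrals differ arbitrarily little by the Lipschitz estimate.
\<close>

lemma markov_kernel_exists:
  assumes ds: "doubly_stochastic \<mu>"
  shows "\<exists>K. is_markov_kernel_of K \<mu>"
proof -
  interpret m: prob_space \<mu> using ds by (rule doubly_stochastic_prob_space)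
  have "\<exists>g. (0 \<le> q \<longrightarrow> q \<le> 1 \<longrightarrow> conditional_cdf \<mu> q g) \<and> (\<forall>x. 0 \<le> g x \<and> g x \<le> 1) \<and> g \<in> borel_measurable unit_lborel \<and>
     (q < 0 \<longrightarrow> g = (\<lambda>_. 0)) \<and> (1 \<le> q \<longrightarrow> g = (\<lambda>_. 1))" for q
  proof -
    consider "q < 0" | "0 \<le> q" "q < 1" | "1 \<le> q" by linarith
    then show ?thesis
    proof cases
      case 2
      with conditional_cdf_exists[OF ds, of q] show ?thesis by (fastforce simp: conditional_cdf_def)
    next
      case 3
      have "conditional_cdf \<mu> 1 (\<lambda>_. 1)"
        unfolding conditional_cdf_def
        using sets_unit_lborel_subset by (auto simp: doubly_stochastic_marginal_fst[OF ds] Int_absorb2)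
      with 3 show ?thesis by (intro exI[of _ "\<lambda>_. 1"]) (auto dest: antisym)
    qed auto
  qed
  then obtain f where f: "\<And>q. 0 \<le> q \<Longrightarrow> q \<le> 1 \<Longrightarrow> conditional_cdf \<mu> q (f q)"
    and f01: "\<And>q x. 0 \<le> f q x" "\<And>q x. f q x \<le> 1"
    and fm [measurable]: "\<And>q. f q \<in> borel_measurable unit_lborel"
    and f0: "\<And>q x. q < 0 \<Longrightarrow> f q x = 0" and f1: "\<And>q x. 1 \<le> q \<Longrightarrow> f q x = 1"
    by metis
  \<comment> \<open>Heights below 0 and from 1 on get the constants 0 and 1, so that the infimum defined below
     has the limits of a distribution function.\<close>
  define Q where "Q y = {q \<in> \<rat>. y < q}" for y :: real
  have Q: "Q y \<noteq> {}" "countable (Q y)" for y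
    using Rats_dense_in_real[of y "y + 1"] countable_subset[OF _ countable_rat, of "Q y"] by (auto simp: Q_def)
  have bdd: "bdd_below ((\<lambda>q. f q x) ` A)" for x A using f01 by (intro bdd_belowI[of _ 0]) auto
  define G where "G x y = (INF q\<in>Q y. f q x)" for x y
  have G_le: "G x y \<le> f q x" if "q \<in> Q y" for x y q
    unfolding G_def using bdd that by (rule cINF_lower)
  have G_ge: "z \<le> G x y" if "\<And>q. q \<in> Q y \<Longrightarrow> z \<le> f q x" for x y z
    unfolding G_def using Q that by (intro cINF_greatest)
  have G01: "0 \<le> G x y" "G x y \<le> 1" for x y
    using f01 G_ge[of y 0 x] G_le[of _ y x] Q(1)[of y] order_trans by blast+
  have Gm [measurable]: "(\<lambda>x. G x y) \<in> borel_measurable unit_lborel" for y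
    unfolding G_def using Q by measurable
  have Gmono: "G x y \<le> G x y'" if "y \<le> y'" for x y y'
    by (rule G_ge, rule G_le) (use that in \<open>auto simp: Q_def\<close>)
  have G0: "G x y = 0" if "y < 0" for x y
  proof -
    obtain q where "q \<in> \<rat>" "y < q" "q < 0" using Rats_dense_in_real[OF \<open>y < 0\<close>] by auto
    then show ?thesis using G_le[of q y x] f0 G01[of x y] by (simp add: Q_def)
  qed
  have G1: "G x y = 1" if "1 \<le> y" for x y
    using G_ge[of y 1 x] f1 G01[of x y] that by (force simp: Q_def)
  have Gcont: "continuous (at_right y) (G x)" for x y
  proof (rule continuous_at_right_real_increasing[THEN iffD2], rule Gmono, assumption, intro allI impI)
    fix e :: real assume "0 < e"
    then have "\<exists>q\<in>Q y. f q x < G x y + e"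
      using G_ge[of y "G x y + e" x] by (smt (verit))
    then obtain q where q: "q \<in> Q y" "f q x < G x y + e" by auto
    then obtain r where "r > y" "r < q" using dense[of y q] by (auto simp: Q_def)
    with q G_le[of q r x] show "\<exists>d>0. G x (y + d) - G x y < e"
      by (intro exI[of _ "r - y"]) (auto simp: Q_def)
  qed
  obtain K where K: "K \<in> unit_lborel \<rightarrow>\<^sub>M prob_algebra unit_lborel"
    and KG: "\<And>x y. 0 \<le> y \<Longrightarrow> y \<le> 1 \<Longrightarrow> measure (K x) {0..y} = G x y"
    using kernel_from_cdf[of G, OF Gm Gmono Gcont G0 G1] by blast
  have Gint: "integrable unit_lborel (\<lambda>x. G x y)" for y
    by (rule U.integrable_const_bound[of _ 1]) (use G01 in auto)
  have "conditional_cdf \<mu> y (\<lambda>x. G x y)" if y: "0 \<le> y" "y \<le> 1" for y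
    unfolding conditional_cdf_def
  proof (intro conjI ballI Gint)
    fix A assume A [measurable]: "A \<in> sets unit_lborel"
    let ?m = "\<lambda>y. measure \<mu> (A \<times> {0..y})" and ?I = "\<integral>x. G x y * indicator A x \<partial>unit_lborel"
    have iG: "integrable unit_lborel (\<lambda>x. G x y * indicator A x)" for y
      using A Gint by (rule integrable_real_mult_indicator)
    have fint: "?m q = (\<integral>x. f q x * indicator A x \<partial>unit_lborel)"
      and ifq: "integrable unit_lborel (\<lambda>x. f q x * indicator A x)" if "0 \<le> q" "q \<le> 1" for q
      using f[OF that] A by (auto simp: conditional_cdf_def intro: integrable_real_mult_indicator)
    \<comment> \<open>The upper estimate uses heights in \<open>(y, 1]\<close> and the lower one heights in \<open>[0, y)\<close>; at the
       end points, where these are missing, the values are known.\<close>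
    have "?I \<le> ?m y"
    proof (cases "y = 1")
      case True
      then show ?thesis using fint[of 1] by (simp add: f1 G1)
    next
      case False
      show ?thesis
      proof (rule field_le_epsilon)
        fix e :: real assume "0 < e"
        with False y obtain q where q: "q \<in> \<rat>" "y < q" "q < min 1 (y + e)"
          using Rats_dense_in_real[of y "min 1 (y + e)"] by auto
        then have q01: "0 \<le> q" "q \<le> 1" using y by auto
        have "?I \<le> ?m q"
          unfolding fint[OF q01] using q y iG ifq[OF q01] G_le[of q y] by (intro integral_mono) (auto simp: Q_def indicator_def)
        also have "\<dots> \<le> ?m y + (q - y)" using q y by (intro doubly_stochastic_strip_Lipschitz[OF ds A]) auto
        finally show "?I \<le> ?m y + e" using q by linarith
      qed
    qed
    moreover have "?m y \<le> ?I"
    proof (cases "y = 0")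
      case True
      have "?m 0 \<le> measure \<mu> ({0..1} \<times> {0..0})"
        using sets_unit_lborel_subset[OF A] ds Icc_in_unit_lborel[of 0 0] by (intro m.finite_measure_mono rectangle_in_doubly_stochastic) auto
      also have "\<dots> = 0" using Icc_in_unit_lborel[of 0 0] measure_unit_lborel_Icc[of 0 0]
        by (subst doubly_stochastic_marginal_snd[OF ds]) auto
      also have "\<dots> \<le> ?I" using G01 by (intro integral_nonneg_AE) auto
      finally show ?thesis using True by simp
    next
      case False
      show ?thesis
      proof (rule field_le_epsilon)
        fix e :: real assume "0 < e"
        with False y obtain q where q: "q \<in> \<rat>" "max 0 (y - e) < q" "q < y"
          using Rats_dense_in_real[of "max 0 (y - e)" y] by auto
        have mono: "AE x in unit_lborel. f q x \<le> f p x" if "p \<in> Q y" for p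
        proof (cases "p \<le> 1")
          case True
          with that q y show ?thesis by (intro conditional_cdf_mono[OF ds f f]) (auto simp: Q_def)
        qed (use f1 f01 in auto)
        have "AE x in unit_lborel. \<forall>p\<in>Q y. f q x \<le> f p x"
          using mono Q by (subst AE_ball_countable) auto
        then have "AE x in unit_lborel. f q x \<le> G x y" by eventually_elim (auto intro: G_ge)
        then have "(\<integral>x. f q x * indicator A x \<partial>unit_lborel) \<le> ?I"
          using q y iG by (intro integral_mono_AE ifq) (auto simp: indicator_def elim!: eventually_mono)
        then have "?m q \<le> ?I" using fint[of q] q y by simp
        moreover have "?m y \<le> ?m q + (y - q)" using q y by (intro doubly_stochastic_strip_Lipschitz[OF ds A]) auto
        ultimately show "?m y \<le> ?I + e" using q by linarith
      qed
    qed
    ultimately show "?m y = ?I" by simp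
  qed
  then have "is_markov_kernel_of K \<mu>"
    by (intro is_markov_kernel_ofI[OF ds K]) (simp add: KG)
  then show ?thesis by blast
qed

section \<open>The metric\<close>

text \<open>
  Evaluate the kernel identity on rectangles \<open>A \<times> {0..y}\<close>. With \<open>conditional_cdf_unique\<close> it
  follows that the kernel chosen in the definition of the distance may be replaced, one height at a
  time, by any other conditional distribution function.
\<close>

lemma markov_kernel_conditional_cdf:
  assumes ds: "doubly_stochastic \<mu>" and K: "is_markov_kernel_of K \<mu>" and y: "0 \<le> y" "y \<le> 1"
  shows "conditional_cdf \<mu> y (\<lambda>x. measure (K x) {0..y})"
proof -
  interpret m: prob_space \<mu> using ds by (rule doubly_stochastic_prob_space)
  have Kp: "K \<in> unit_lborel \<rightarrow>\<^sub>M prob_algebra unit_lborel" using K by (simp add: is_markov_kernel_of_def)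
  have pr: "prob_space (K x)" if "x \<in> {0..1}" for x
    using measurable_space[OF Kp, of x] that by (simp add: space_prob_algebra)
  have int: "integrable unit_lborel (\<lambda>x. measure (K x) {0..y})"
  proof (rule U.integrable_const_bound[of _ 1])
    show "AE x in unit_lborel. norm (measure (K x) {0..y}) \<le> 1"
      by (rule AE_I2) (simp add: pr prob_space.prob_le_1)
    show "(\<lambda>x. measure (K x) {0..y}) \<in> borel_measurable unit_lborel"
      by (rule measurable_compose[OF Kp measurable_measure_prob_algebra]) (use y in simp)
  qed
  show ?thesis
    unfolding conditional_cdf_def
  proof (intro conjI ballI int)
    fix A assume A: "A \<in> sets unit_lborel"
    have "ennreal (measure \<mu> (A \<times> {0..y})) = (\<integral>\<^sup>+x. emeasure (K x) (Pair x -` (A \<times> {0..y})) \<partial>unit_lborel)"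
      using K A y by (simp add: is_markov_kernel_of_def m.emeasure_eq_measure[symmetric] sets_unit_square_borel)
    also have "\<dots> = (\<integral>\<^sup>+x. ennreal (measure (K x) {0..y} * indicator A x) \<partial>unit_lborel)"
    proof (rule nn_integral_cong)
      fix x assume "x \<in> space unit_lborel"
      then interpret prob_space "K x" using pr by simp
      show "emeasure (K x) (Pair x -` (A \<times> {0..y})) = ennreal (measure (K x) {0..y} * indicator A x)"
        by (simp add: Pair_vimage_Sigma indicator_def emeasure_eq_measure)
    qed
    also have "\<dots> = ennreal (\<integral>x. measure (K x) {0..y} * indicator A x \<partial>unit_lborel)"
      by (rule nn_integral_eq_integral) (use integrable_real_mult_indicator[OF A int] in simp_all)
    finally show "measure \<mu> (A \<times> {0..y}) = (\<integral>x. measure (K x) {0..y} * indicator A x \<partial>unit_lborel)"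
      by (subst (asm) ennreal_inj) (auto intro!: integral_nonneg_AE)
  qed
qed

abbreviation kernel_cdf :: "(real \<times> real \<Rightarrow> real) \<Rightarrow> real \<Rightarrow> real \<Rightarrow> real" where
  "kernel_cdf C y x \<equiv> measure (copula_kernel C x) {0..y}"

lemma copula_kernel_is_markov_kernel:
  assumes "doubly_stochastic \<mu>"
  shows "is_markov_kernel_of (copula_kernel (copula_of \<mu>)) \<mu>"
  unfolding copula_kernel_def copula_measure_copula_of[OF assms]
  using markov_kernel_exists[OF assms] by (rule someI_ex)

lemma conditional_cdf_kernel_cdf:
  assumes "doubly_stochastic \<mu>" "0 \<le> y" "y \<le> 1"
  shows "conditional_cdf \<mu> y (kernel_cdf (copula_of \<mu>) y)"
  using assms copula_kernel_is_markov_kernel markov_kernel_conditional_cdf by blast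

lemma measurable_copula_kernel:
  "C \<in> copulas \<Longrightarrow> copula_kernel C \<in> unit_lborel \<rightarrow>\<^sub>M prob_algebra unit_lborel"
  using copula_kernel_is_markov_kernel by (auto simp: copulas_def is_markov_kernel_of_def)

lemma kernel_cdf_le_1: "C \<in> copulas \<Longrightarrow> x \<in> {0..1} \<Longrightarrow> kernel_cdf C y x \<le> 1"
  using measurable_space[OF measurable_copula_kernel, of C x]
  by (auto simp: space_prob_algebra prob_space.prob_le_1)

lemma abs_kernel_cdf_diff_le_1:
  assumes "C \<in> copulas" "C' \<in> copulas" "x \<in> {0..1}"
  shows "\<bar>kernel_cdf C y x - kernel_cdf C' y x\<bar> \<le> 1"
  using kernel_cdf_le_1[OF assms(1,3), of y] kernel_cdf_le_1[OF assms(2,3), of y]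
    measure_nonneg[of "copula_kernel C x" "{0..y}"] measure_nonneg[of "copula_kernel C' x" "{0..y}"]
  by linarith

text \<open>
  Joint measurability in height and point, needed for the inner integral of the distance to be
  a measurable function of the height.
\<close>

lemma measurable_kernel_cdf:
  assumes "C \<in> copulas"
  shows "(\<lambda>(y, x). kernel_cdf C y x) \<in> borel_measurable (unit_lborel \<Otimes>\<^sub>M unit_lborel)"
proof -
  let ?S = "unit_lborel \<Otimes>\<^sub>M unit_lborel"
  have id [measurable]: "(\<lambda>x. x) \<in> borel_measurable unit_lborel" by measurable
  have [measurable]: "fst \<in> borel_measurable ?S" "(\<lambda>w. fst (fst w)) \<in> borel_measurable (?S \<Otimes>\<^sub>M unit_lborel)"
    "snd \<in> borel_measurable (?S \<Otimes>\<^sub>M unit_lborel)"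
    using measurable_compose[OF measurable_fst id]
      measurable_compose[OF measurable_compose[OF measurable_fst measurable_fst] id]
      measurable_compose[OF measurable_snd id] by simp_all
  have "{w \<in> space (?S \<Otimes>\<^sub>M unit_lborel). snd w \<le> fst (fst w)} \<in> sets (?S \<Otimes>\<^sub>M unit_lborel)"
    by measurable
  also have "{w \<in> space (?S \<Otimes>\<^sub>M unit_lborel). snd w \<le> fst (fst w)} = (SIGMA z:space ?S. {0..fst z})"
    by (auto simp: space_pair_measure)
  finally have "(\<lambda>z. measure (copula_kernel C (snd z)) {0..fst z}) \<in> borel_measurable ?S"
    by (rule measure_measurable_prob_algebra2)
       (rule measurable_compose[OF measurable_snd measurable_copula_kernel[OF assms]])
  then show ?thesis by (simp add: case_prod_beta')
qed

lemma measurable_kernel_cdf_section: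
  assumes "C \<in> copulas" "y \<in> {0..1}"
  shows "kernel_cdf C y \<in> borel_measurable unit_lborel"
  by (rule measurable_compose[OF measurable_copula_kernel[OF assms(1)] measurable_measure_prob_algebra])
     (use assms in simp)

text \<open>
  Named separately because versions of the kernel can be exchanged, and the triangle inequality
  checked, at one height at a time.
\<close>

definition section_dist :: "(real \<times> real \<Rightarrow> real) \<Rightarrow> (real \<times> real \<Rightarrow> real) \<Rightarrow> real \<Rightarrow> real" where
  "section_dist C C' y = (LINT x|unit_lborel. \<bar>kernel_cdf C y x - kernel_cdf C' y x\<bar>)"

lemma D1_eq_section_dist: "D1 C C' = (LINT y|unit_lborel. section_dist C C' y)"
  by (simp add: D1_def section_dist_def)

lemma integrable_kernel_cdf_diff:
  assumes "C \<in> copulas" "C' \<in> copulas" "y \<in> {0..1}"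
  shows "integrable unit_lborel (\<lambda>x. \<bar>kernel_cdf C y x - kernel_cdf C' y x\<bar>)"
proof (rule U.integrable_const_bound[of _ 1])
  note [measurable] = measurable_kernel_cdf_section[OF assms(1,3)] measurable_kernel_cdf_section[OF assms(2,3)]
  show "(\<lambda>x. \<bar>kernel_cdf C y x - kernel_cdf C' y x\<bar>) \<in> borel_measurable unit_lborel" by measurable
  show "AE x in unit_lborel. norm \<bar>kernel_cdf C y x - kernel_cdf C' y x\<bar> \<le> 1"
    using abs_kernel_cdf_diff_le_1[OF assms(1,2)] by (intro AE_I2) simp
qed

lemma section_dist_nonneg: "0 \<le> section_dist C C' y"
  by (simp add: section_dist_def)

lemma section_dist_triangle:
  assumes "C \<in> copulas" "C' \<in> copulas" "C'' \<in> copulas" "y \<in> {0..1}"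
  shows "section_dist C C'' y \<le> section_dist C C' y + section_dist C' C'' y"
proof -
  have "section_dist C C'' y \<le> (LINT x|unit_lborel.
      \<bar>kernel_cdf C y x - kernel_cdf C' y x\<bar> + \<bar>kernel_cdf C' y x - kernel_cdf C'' y x\<bar>)"
    unfolding section_dist_def using assms
    by (intro integral_mono Bochner_Integration.integrable_add integrable_kernel_cdf_diff) auto
  also have "\<dots> = section_dist C C' y + section_dist C' C'' y"
    unfolding section_dist_def using assms
    by (intro Bochner_Integration.integral_add integrable_kernel_cdf_diff)
  finally show ?thesis .
qed

lemma integrable_section_dist:
  assumes "C \<in> copulas" "C' \<in> copulas"
  shows "integrable unit_lborel (section_dist C C')"
proof (rule U.integrable_const_bound[of _ 1])
  note [measurable] = measurable_kernel_cdf[OF assms(1)] measurable_kernel_cdf[OF assms(2)]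
  show "section_dist C C' \<in> borel_measurable unit_lborel"
    unfolding section_dist_def by measurable
  have "section_dist C C' y \<le> 1" if "y \<in> {0..1}" for y
  proof -
    have "section_dist C C' y \<le> (LINT x|unit_lborel. 1)"
      unfolding section_dist_def
      using assms that abs_kernel_cdf_diff_le_1[OF assms]
      by (intro integral_mono integrable_kernel_cdf_diff) auto
    then show ?thesis by simp
  qed
  then show "AE y in unit_lborel. norm (section_dist C C' y) \<le> 1"
    by (intro AE_I2) (simp add: section_dist_nonneg)
qed

lemma section_dist_conditional_cdf:
  assumes "doubly_stochastic \<mu>" "doubly_stochastic \<nu>" "0 \<le> y" "y \<le> 1"
    and g: "conditional_cdf \<mu> y g" and h: "conditional_cdf \<nu> y h"
  shows "section_dist (copula_of \<mu>) (copula_of \<nu>) y = (LINT x|unit_lborel. \<bar>g x - h x\<bar>)"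
proof -
  have k: "conditional_cdf \<mu> y (kernel_cdf (copula_of \<mu>) y)" "conditional_cdf \<nu> y (kernel_cdf (copula_of \<nu>) y)"
    using assms by (auto intro: conditional_cdf_kernel_cdf)
  then have [measurable]: "g \<in> borel_measurable unit_lborel" "h \<in> borel_measurable unit_lborel"
    "kernel_cdf (copula_of \<mu>) y \<in> borel_measurable unit_lborel"
    "kernel_cdf (copula_of \<nu>) y \<in> borel_measurable unit_lborel"
    using g h by (auto simp: conditional_cdf_def)
  show ?thesis
    unfolding section_dist_def
  proof (rule integral_cong_AE)
    show "AE x in unit_lborel. \<bar>kernel_cdf (copula_of \<mu>) y x - kernel_cdf (copula_of \<nu>) y x\<bar> = \<bar>g x - h x\<bar>"
      using conditional_cdf_unique[OF k(1) g] conditional_cdf_unique[OF k(2) h] by eventually_elim simp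
  qed measurable
qed

lemma AE_unit_lborel_ex:
  assumes "AE y in unit_lborel. P y" "0 \<le> a" "a < b" "b \<le> 1"
  shows "\<exists>y\<in>{a..b}. P y"
proof (rule ccontr)
  assume "\<not> ?thesis"
  with assms(1) have "AE y in unit_lborel. y \<notin> {a..b}" by (auto elim!: eventually_mono)
  then have "emeasure unit_lborel {a..b} = 0"
    using AE_iff_measurable[of "{a..b}" unit_lborel "\<lambda>y. y \<notin> {a..b}"] assms by force
  then show False using assms by (simp add: emeasure_unit_lborel)
qed

text \<open>
  At almost every height the two kernels have the same conditional distribution function, so the two
  measures agree on all rectangles of that height. Such heights are dense, and the Lipschitz
  estimate carries the agreement to every height.
\<close>

lemma D1_eq_0_imp_eq:
  assumes \<mu>: "doubly_stochastic \<mu>" and \<nu>: "doubly_stochastic \<nu>" and D: "D1 (copula_of \<mu>) (copula_of \<nu>) = 0"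
  shows "\<mu> = \<nu>"
proof (rule measure_eq_on_square)
  let ?C = "copula_of \<mu>" and ?C' = "copula_of \<nu>"
  have C: "?C \<in> copulas" "?C' \<in> copulas" using \<mu> \<nu> by (auto simp: copulas_def)
  have "AE y in unit_lborel. section_dist ?C ?C' y = 0"
    using D integrable_section_dist[OF C] section_dist_nonneg
    unfolding D1_eq_section_dist by (subst integral_nonneg_eq_0_iff_AE[symmetric]) auto
  then have good: "AE y in unit_lborel. \<forall>A\<in>sets unit_lborel. measure \<mu> (A \<times> {0..y}) = measure \<nu> (A \<times> {0..y})"
    using AE_space
  proof eventually_elim
    case (elim y)
    then have y: "0 \<le> y" "y \<le> 1" by auto
    have "AE x in unit_lborel. \<bar>kernel_cdf ?C y x - kernel_cdf ?C' y x\<bar> = 0"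
      using elim(1) integrable_kernel_cdf_diff[OF C] y
      unfolding section_dist_def by (subst integral_nonneg_eq_0_iff_AE[symmetric]) auto
    then have eq: "AE x in unit_lborel. kernel_cdf ?C y x = kernel_cdf ?C' y x" by simp
    note k = conditional_cdf_kernel_cdf[OF \<mu> y] conditional_cdf_kernel_cdf[OF \<nu> y]
    then have m [measurable]: "kernel_cdf ?C y \<in> borel_measurable unit_lborel"
      "kernel_cdf ?C' y \<in> borel_measurable unit_lborel" by (auto simp: conditional_cdf_def)
    show ?case
    proof
      fix A assume A [measurable]: "A \<in> sets unit_lborel"
      have "(\<integral>x. kernel_cdf ?C y x * indicator A x \<partial>unit_lborel) = (\<integral>x. kernel_cdf ?C' y x * indicator A x \<partial>unit_lborel)"
      proof (rule integral_cong_AE)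
        show "AE x in unit_lborel. kernel_cdf ?C y x * indicator A x = kernel_cdf ?C' y x * indicator A x"
          using eq by eventually_elim simp
      qed measurable
      then show "measure \<mu> (A \<times> {0..y}) = measure \<nu> (A \<times> {0..y})"
        using k A by (simp add: conditional_cdf_def)
    qed
  qed
  fix x y :: real assume x: "x \<in> {0..1}" and y: "y \<in> {0..1}"
  have A: "{0..x} \<in> sets unit_lborel" using x by simp
  show "measure \<mu> ({0..x} \<times> {0..y}) = measure \<nu> ({0..x} \<times> {0..y})" (is "?m y = ?n y")
  proof (cases "y = 1")
    case True
    then show ?thesis using \<mu> \<nu> A by (simp add: doubly_stochastic_marginal_fst)
  next
    case False
    have "\<bar>?m y - ?n y\<bar> \<le> 0 + e" if "0 < e" for e
    proof -
      have "0 \<le> y" "y < min 1 (y + e)" "min 1 (y + e) \<le> 1" using y False that by auto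
      from AE_unit_lborel_ex[OF good this] A obtain y' where
        y': "y \<le> y'" "y' \<le> 1" "y' \<le> y + e" "?m y' = ?n y'" by auto
      from doubly_stochastic_strip_mono[OF \<mu> A _ y'(1,2)] doubly_stochastic_strip_mono[OF \<nu> A _ y'(1,2)]
        doubly_stochastic_strip_Lipschitz[OF \<mu> A _ y'(1,2)] doubly_stochastic_strip_Lipschitz[OF \<nu> A _ y'(1,2)]
      show ?thesis using y' y by auto
    qed
    then have "\<bar>?m y - ?n y\<bar> \<le> 0" by (rule field_le_epsilon)
    then show ?thesis by simp
  qed
qed (use \<mu> \<nu> in \<open>auto simp: doubly_stochastic_def prob_space_def\<close>)

lemma Metric_space_D1: "Metric_space copulas D1"
proof
  fix C C' C'' :: "real \<times> real \<Rightarrow> real"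
  show "0 \<le> D1 C C'"
    by (simp add: D1_eq_section_dist section_dist_nonneg)
  show "D1 C C' = D1 C' C"
    by (simp add: D1_def abs_minus_commute)
  assume C: "C \<in> copulas" and C': "C' \<in> copulas"
  show "D1 C C' = 0 \<longleftrightarrow> C = C'"
  proof
    assume "D1 C C' = 0"
    then show "C = C'" using C C' D1_eq_0_imp_eq by (auto simp: copulas_def)
  qed (simp add: D1_def)
  assume C'': "C'' \<in> copulas"
  have "D1 C C'' \<le> (LINT y|unit_lborel. section_dist C C' y + section_dist C' C'' y)"
    unfolding D1_eq_section_dist using C C' C''
    by (intro integral_mono Bochner_Integration.integrable_add integrable_section_dist section_dist_triangle) auto
  also have "\<dots> = D1 C C' + D1 C' C''"
    unfolding D1_eq_section_dist using C C' C''
    by (intro Bochner_Integration.integral_add integrable_section_dist)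
  finally show "D1 C C'' \<le> D1 C C' + D1 C' C''" .
qed

section \<open>Oscillating copulas\<close>

lemma integral_unit_lborel: "(\<integral>x. f x \<partial>unit_lborel) = (\<integral>x. f x * indicator {0..1} x \<partial>lborel)"
  for f :: "real \<Rightarrow> real"
  by (simp add: unit_lborel_def integral_restrict_space mult.commute)

lemma integrable_unit_lborel_bounded:
  fixes f :: "real \<Rightarrow> real"
  assumes "f \<in> borel_measurable borel" "\<And>x. \<bar>f x\<bar> \<le> B"
  shows "integrable unit_lborel f"
  by (rule U.integrable_const_bound[of _ B]) (use assms in \<open>auto intro: measurable_unit_lborelI\<close>)

lemma integrable_indicator_unit: "A \<in> sets unit_lborel \<Longrightarrow> integrable unit_lborel (indicator A :: real \<Rightarrow> real)"
  by (simp add: U.emeasure_eq_measure)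

text \<open>
  The functions whose orthogonality keeps the perturbations apart. Nonzero integer frequencies
  give them mean zero over the unit interval.
\<close>

definition wave :: "int \<Rightarrow> real \<Rightarrow> real" where
  "wave k x = cos (2 * pi * of_int k * x)"

lemma wave_0 [simp]: "wave 0 x = 1"
  by (simp add: wave_def)

lemma abs_wave_le_1: "\<bar>wave k x\<bar> \<le> 1"
  by (simp add: wave_def)

lemma borel_measurable_wave [measurable]: "wave k \<in> borel_measurable borel"
  unfolding wave_def by measurable

lemma measurable_wave: "wave k \<in> borel_measurable unit_lborel"
  by (rule measurable_unit_lborelI) measurable

lemma integrable_wave: "integrable unit_lborel (wave k)"
  by (rule integrable_unit_lborel_bounded[of _ 1]) (auto simp: abs_wave_le_1)

lemma integral_wave_Icc:
  assumes "k \<noteq> 0" "0 \<le> y" "y \<le> 1"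
  shows "(\<integral>x. wave k x * indicator {0..y} x \<partial>unit_lborel) = sin (2 * pi * of_int k * y) / (2 * pi * of_int k)"
proof -
  have "(\<integral>x. wave k x * indicator {0..y} x \<partial>unit_lborel) = (\<integral>x. wave k x * indicator {0..y} x \<partial>lborel)"
    unfolding integral_unit_lborel using assms by (intro Bochner_Integration.integral_cong) (auto simp: indicator_def)
  also have "\<dots> = sin (2 * pi * of_int k * y) / (2 * pi * of_int k) - sin (2 * pi * of_int k * 0) / (2 * pi * of_int k)"
    using assms unfolding wave_def
    by (intro integral_FTC_Icc_real) (auto intro!: derivative_eq_intros simp: field_simps)
  finally show ?thesis by simp
qed

lemma integral_wave: "k \<noteq> 0 \<Longrightarrow> (\<integral>x. wave k x \<partial>unit_lborel) = 0"
proof -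
  assume "k \<noteq> 0"
  have "(\<integral>x. wave k x \<partial>unit_lborel) = (\<integral>x. wave k x * indicator {0..1} x \<partial>unit_lborel)"
    by (intro Bochner_Integration.integral_cong) auto
  also have "\<dots> = sin (2 * pi * of_int k * 1) / (2 * pi * of_int k)"
    using \<open>k \<noteq> 0\<close> by (rule integral_wave_Icc) auto
  also have "sin (2 * pi * of_int k * 1) = 0"
    using sin_int_2pin[of k] by simp
  finally show ?thesis by simp
qed

lemma wave_mult: "wave k x * wave l x = (wave (k - l) x + wave (k + l) x) / 2"
  by (simp add: wave_def cos_times_cos algebra_simps)

text \<open>
  Orthogonality gives the squared difference integral 1. The difference is at most 2 in
  absolute value, so its square is at most twice its absolute value.
\<close>

lemma wave_L1_separated:
  assumes "0 < k" "0 < l" "k \<noteq> l"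
  shows "1 / 2 \<le> (\<integral>x. \<bar>wave k x - wave l x\<bar> \<partial>unit_lborel)"
proof -
  have sq: "(wave k x - wave l x)\<^sup>2 =
      1 + (wave (k + k) x + wave (l + l) x) / 2 - wave (k - l) x - wave (k + l) x" for x
  proof -
    have "(wave k x - wave l x)\<^sup>2 = wave k x * wave k x + wave l x * wave l x - 2 * (wave k x * wave l x)"
      by (simp add: power2_eq_square algebra_simps)
    then show ?thesis unfolding wave_mult by (simp add: add_divide_distrib)
  qed
  have "(\<integral>x. (wave k x - wave l x)\<^sup>2 \<partial>unit_lborel) = 1"
    unfolding sq using assms by (simp add: integrable_wave integral_wave)
  moreover have "(\<integral>x. (wave k x - wave l x)\<^sup>2 \<partial>unit_lborel) \<le> (\<integral>x. 2 * \<bar>wave k x - wave l x\<bar> \<partial>unit_lborel)"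
  proof (rule integral_mono)
    show "integrable unit_lborel (\<lambda>x. (wave k x - wave l x)\<^sup>2)"
      unfolding sq by (simp add: integrable_wave)
    show "integrable unit_lborel (\<lambda>x. 2 * \<bar>wave k x - wave l x\<bar>)"
      by (simp add: integrable_wave)
    fix x
    have "\<bar>wave k x - wave l x\<bar> \<le> 2"
      using abs_wave_le_1[of k x] abs_wave_le_1[of l x] by linarith
    then have "\<bar>wave k x - wave l x\<bar> * \<bar>wave k x - wave l x\<bar> \<le> 2 * \<bar>wave k x - wave l x\<bar>"
      by (rule mult_right_mono) simp
    then show "(wave k x - wave l x)\<^sup>2 \<le> 2 * \<bar>wave k x - wave l x\<bar>"
      by (simp add: power2_eq_square)
  qed
  ultimately show ?thesis by simp
qed

text \<open>
  A perturbation of the uniform distribution on the square that oscillates with frequency \<open>k\<close> in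
  the first coordinate. For nonzero \<open>k\<close> both factors have mean zero, so neither marginal changes.
\<close>

definition wave_measure :: "int \<Rightarrow> (real \<times> real) measure" where
  "wave_measure k = density (unit_lborel \<Otimes>\<^sub>M unit_lborel) (\<lambda>(x, y). ennreal (1 + wave k x * wave 1 y))"

lemma sets_wave_measure: "sets (wave_measure k) = sets (unit_lborel \<Otimes>\<^sub>M unit_lborel)"
  by (simp add: wave_measure_def)

lemma wave_measure_rectangle:
  fixes k :: int
  assumes A[measurable]: "A \<in> sets unit_lborel" and B[measurable]: "B \<in> sets unit_lborel"
  defines "m \<equiv> measure unit_lborel A * measure unit_lborel B +
     (\<integral>x. wave k x * indicator A x \<partial>unit_lborel) * (\<integral>y. wave 1 y * indicator B y \<partial>unit_lborel)"
  shows "emeasure (wave_measure k) (A \<times> B) = ennreal m" and "measure (wave_measure k) (A \<times> B) = m"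
proof -
  let ?S = "unit_lborel \<Otimes>\<^sub>M unit_lborel"
  note [measurable] = measurable_wave
  let ?f = "\<lambda>z. (1 + wave k (fst z) * wave 1 (snd z)) * indicator (A \<times> B) z"
  have nn: "\<bar>wave k x * wave 1 y\<bar> \<le> 1" for x y
    by (simp only: abs_mult) (rule mult_le_one, auto simp: abs_wave_le_1)
  then have nn': "0 \<le> 1 + wave k x * wave 1 y" "1 + wave k x * wave 1 y \<le> 2" for x y
    using nn[of x y] by linarith+
  have int: "integrable ?S ?f"
  proof (rule UU.P.integrable_const_bound[of _ 2])
    show "AE z in ?S. norm (?f z) \<le> 2"
      using nn' by (intro AE_I2) (auto simp: indicator_def)
  qed measurable
  have "emeasure (wave_measure k) (A \<times> B) = (\<integral>\<^sup>+z. ennreal (?f z) \<partial>?S)"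
    unfolding wave_measure_def using nn'
    by (subst emeasure_density) (measurable, auto intro!: nn_integral_cong simp: indicator_def)
  also have "\<dots> = ennreal (\<integral>z. ?f z \<partial>?S)"
    by (rule nn_integral_eq_integral[OF int]) (use nn' in \<open>auto simp: indicator_def\<close>)
  finally have em: "emeasure (wave_measure k) (A \<times> B) = ennreal (\<integral>z. ?f z \<partial>?S)" .
  have "(\<integral>z. ?f z \<partial>?S) = (\<integral>x. (\<integral>y. ?f (x, y) \<partial>unit_lborel) \<partial>unit_lborel)"
    by (rule UU.integral_fst'[OF int, symmetric])
  also have "\<dots> = (\<integral>x. indicator A x * measure unit_lborel B +
      (wave k x * indicator A x) * (\<integral>y. wave 1 y * indicator B y \<partial>unit_lborel) \<partial>unit_lborel)"
  proof (rule Bochner_Integration.integral_cong[OF refl])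
    fix x
    have "(\<integral>y. ?f (x, y) \<partial>unit_lborel) = (\<integral>y. indicator A x * indicator B y +
        (wave k x * indicator A x) * (wave 1 y * indicator B y) \<partial>unit_lborel)"
      by (rule Bochner_Integration.integral_cong) (auto simp: indicator_def)
    also have "\<dots> = indicator A x * measure unit_lborel B +
      (wave k x * indicator A x) * (\<integral>y. wave 1 y * indicator B y \<partial>unit_lborel)"
      using integrable_indicator_unit[OF B] integrable_real_mult_indicator[OF B integrable_wave[of 1]] sets_unit_lborel_subset[OF B]
      by (subst Bochner_Integration.integral_add) (auto simp: Int_absorb2)
    finally show "(\<integral>y. ?f (x, y) \<partial>unit_lborel) = indicator A x * measure unit_lborel B +
      (wave k x * indicator A x) * (\<integral>y. wave 1 y * indicator B y \<partial>unit_lborel)" .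
  qed
  also have "\<dots> = m"
    unfolding m_def using integrable_indicator_unit[OF A] integrable_real_mult_indicator[OF A integrable_wave[of k]] sets_unit_lborel_subset[OF A]
    by (subst Bochner_Integration.integral_add) (auto simp: Int_absorb2)
  finally have m: "(\<integral>z. ?f z \<partial>?S) = m" .
  then show "emeasure (wave_measure k) (A \<times> B) = ennreal m" using em by simp
  moreover have "0 \<le> m"
    unfolding m[symmetric] using nn' by (intro integral_nonneg_AE AE_I2) (auto simp: indicator_def)
  ultimately show "measure (wave_measure k) (A \<times> B) = m" by (simp add: measure_def)
qed

lemma integral_wave_unit: "k \<noteq> 0 \<Longrightarrow> (\<integral>x. wave k x * indicator {0..1} x \<partial>unit_lborel) = 0"
  using integral_wave[of k] Bochner_Integration.integral_cong[OF refl, of unit_lborel "\<lambda>x. wave k x * indicator {0..1} x" "wave k"]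
  by simp

lemma doubly_stochastic_wave_measure:
  assumes "k \<noteq> 0"
  shows "doubly_stochastic (wave_measure k)"
proof -
  have sp: "space (wave_measure k) = {0..1} \<times> {0..1}"
    using sets_eq_imp_space_eq[OF sets_wave_measure] by (simp add: space_pair_measure)
  have m: "fst \<in> wave_measure k \<rightarrow>\<^sub>M unit_lborel" "snd \<in> wave_measure k \<rightarrow>\<^sub>M unit_lborel"
    by (simp_all add: wave_measure_def)
  have "prob_space (wave_measure k)"
    by (rule prob_spaceI) (simp add: sp wave_measure_rectangle integral_wave_unit[OF assms])
  moreover have "distr (wave_measure k) unit_lborel fst = unit_lborel"
  proof (rule measure_eqI)
    fix A assume "A \<in> sets (distr (wave_measure k) unit_lborel fst)"
    then have A: "A \<in> sets unit_lborel" by simp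
    have "fst -` A \<inter> space (wave_measure k) = A \<times> {0..1}"
      using sets_unit_lborel_subset[OF A] by (auto simp: sp)
    then show "emeasure (distr (wave_measure k) unit_lborel fst) A = emeasure unit_lborel A"
      using A by (simp add: emeasure_distr[OF m(1)] wave_measure_rectangle integral_wave_unit[of 1] U.emeasure_eq_measure)
  qed simp
  moreover have "distr (wave_measure k) unit_lborel snd = unit_lborel"
  proof (rule measure_eqI)
    fix A assume "A \<in> sets (distr (wave_measure k) unit_lborel snd)"
    then have A: "A \<in> sets unit_lborel" by simp
    have "snd -` A \<inter> space (wave_measure k) = {0..1} \<times> A"
      using sets_unit_lborel_subset[OF A] by (auto simp: sp)
    then show "emeasure (distr (wave_measure k) unit_lborel snd) A = emeasure unit_lborel A"
      using A by (simp add: emeasure_distr[OF m(2)] wave_measure_rectangle integral_wave_unit[OF assms] U.emeasure_eq_measure)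
  qed simp
  ultimately show ?thesis
    by (simp add: doubly_stochastic_def sets_wave_measure sets_unit_square_borel)
qed

lemma conditional_cdf_wave_measure:
  assumes "k \<noteq> 0" "0 \<le> y" "y \<le> 1"
  shows "conditional_cdf (wave_measure k) y (\<lambda>x. y + wave k x * (sin (2 * pi * y) / (2 * pi)))"
  unfolding conditional_cdf_def
proof (intro conjI ballI)
  show "integrable unit_lborel (\<lambda>x. y + wave k x * (sin (2 * pi * y) / (2 * pi)))"
    using integrable_wave by (intro Bochner_Integration.integrable_add integrable_mult_left) auto
  fix A assume A [measurable]: "A \<in> sets unit_lborel"
  have iA: "integrable unit_lborel (\<lambda>x. wave k x * indicator A x)"
    by (rule integrable_real_mult_indicator[OF A integrable_wave])
  have "measure (wave_measure k) (A \<times> {0..y}) = measure unit_lborel A * y +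
     (\<integral>x. wave k x * indicator A x \<partial>unit_lborel) * (sin (2 * pi * y) / (2 * pi))"
    using assms integral_wave_Icc[of 1 y] by (simp add: wave_measure_rectangle(2)[OF A])
  also have "\<dots> =
    (\<integral>x. indicator A x * y + (wave k x * indicator A x) * (sin (2 * pi * y) / (2 * pi)) \<partial>unit_lborel)"
    using integrable_indicator_unit[OF A] iA sets_unit_lborel_subset[OF A] by (subst Bochner_Integration.integral_add) (auto simp: Int_absorb2)
  also have "\<dots> = (\<integral>x. (y + wave k x * (sin (2 * pi * y) / (2 * pi))) * indicator A x \<partial>unit_lborel)"
    by (rule Bochner_Integration.integral_cong) (auto simp: algebra_simps)
  finally show "measure (wave_measure k) (A \<times> {0..y}) =
     (\<integral>x. (y + wave k x * (sin (2 * pi * y) / (2 * pi))) * indicator A x \<partial>unit_lborel)" .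
qed

section \<open>Mixtures\<close>

text \<open>
  The mixture is the law of the following experiment: toss a coin with success probability \<open>e\<close>, then
  draw from \<open>\<nu>\<close> or \<open>\<mu>\<close>. Either way the marginals are Lebesgue measure, so they are for the
  mixture.
\<close>

lemma doubly_stochastic_mixture:
  assumes \<mu>: "doubly_stochastic \<mu>" and \<nu>: "doubly_stochastic \<nu>" and e: "0 \<le> e" "e \<le> 1"
  shows "\<exists>\<rho>. doubly_stochastic \<rho> \<and>
           (\<forall>A\<in>sets unit_square_borel. measure \<rho> A = (1 - e) * measure \<mu> A + e * measure \<nu> A)"
proof -
  let ?S = "unit_square_borel" and ?b = "measure_pmf (bernoulli_pmf e)"
  let ?N = "\<lambda>b. if b then \<nu> else \<mu>"
  have s: "sets \<mu> = sets ?S" "sets \<nu> = sets ?S" and d: "distr (?N b) unit_lborel fst = unit_lborel"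
    "distr (?N b) unit_lborel snd = unit_lborel" for b
    using \<mu> \<nu> by (auto simp: doubly_stochastic_def)
  note pr = \<mu>[THEN doubly_stochastic_prob_space] \<nu>[THEN doubly_stochastic_prob_space]
  interpret m: prob_space \<mu> by (rule pr)
  interpret n: prob_space \<nu> by (rule pr)
  have b: "?b \<in> space (prob_algebra (count_space UNIV))"
    by (simp add: space_prob_algebra measure_pmf.prob_space_axioms)
  have N: "?N \<in> count_space UNIV \<rightarrow>\<^sub>M prob_algebra ?S"
    using s pr by (auto simp: space_prob_algebra)
  have N': "?N \<in> ?b \<rightarrow>\<^sub>M subprob_algebra ?S"
    using measurable_prob_algebraD[OF N] by (simp cong: measurable_cong_sets)
  define \<rho> where "\<rho> = ?b \<bind> ?N"
  have \<rho>: "prob_space \<rho>" "sets \<rho> = sets ?S"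
    unfolding \<rho>_def by (rule prob_space_bind'[OF b N], rule sets_bind'[OF b N])
  have f: "fst \<in> ?S \<rightarrow>\<^sub>M unit_lborel" "snd \<in> ?S \<rightarrow>\<^sub>M unit_lborel"
    using measurable_cong_sets[OF sets_unit_square_borel refl, of unit_lborel] by auto
  have "distr \<rho> unit_lborel p = unit_lborel"
    if p: "p \<in> ?S \<rightarrow>\<^sub>M unit_lborel" "\<And>b. distr (?N b) unit_lborel p = unit_lborel" for p
    unfolding \<rho>_def
    by (subst distr_bind[OF N' _ p(1)], simp, unfold p(2))
       (rule bind_const', auto intro: prob_space_imp_subprob_space U.prob_space_axioms measure_pmf.prob_space_axioms)
  from this[OF f(1) d(1)] this[OF f(2) d(2)] have "doubly_stochastic \<rho>"
    using \<rho> by (simp add: doubly_stochastic_def)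
  moreover have "measure \<rho> A = (1 - e) * measure \<mu> A + e * measure \<nu> A" if "A \<in> sets ?S" for A
  proof -
    interpret r: prob_space \<rho> by (rule \<rho>)
    have "ennreal (measure \<rho> A) = (\<integral>\<^sup>+b. emeasure (?N b) A \<partial>?b)"
      unfolding r.emeasure_eq_measure[symmetric] unfolding \<rho>_def by (rule emeasure_bind_prob_algebra[OF b N that])
    also have "\<dots> = ennreal ((1 - e) * measure \<mu> A + e * measure \<nu> A)"
    proof -
      have "(\<integral>\<^sup>+b. emeasure (?N b) A \<partial>?b) = ennreal (measure \<nu> A) * ennreal e + ennreal (measure \<mu> A) * ennreal (1 - e)"
        using e by (subst nn_integral_bernoulli_pmf) (simp_all add: m.emeasure_eq_measure n.emeasure_eq_measure)
      also have "\<dots> = ennreal (measure \<nu> A * e + measure \<mu> A * (1 - e))"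
        using e by (simp only: ennreal_mult[symmetric] ennreal_plus[symmetric] measure_nonneg diff_ge_0_iff_ge mult_nonneg_nonneg)
      also have "measure \<nu> A * e + measure \<mu> A * (1 - e) = (1 - e) * measure \<mu> A + e * measure \<nu> A"
        by simp
      finally show ?thesis .
    qed
    finally show ?thesis using e by (subst (asm) ennreal_inj) auto
  qed
  ultimately show ?thesis by blast
qed

section \<open>No closed ball is compact\<close>

lemma conditional_cdf_mixture:
  assumes "conditional_cdf \<mu> y g" "conditional_cdf \<nu> y h" "y \<in> {0..1}"
    and mix: "\<And>A. A \<in> sets unit_square_borel \<Longrightarrow> measure \<rho> A = (1 - e) * measure \<mu> A + e * measure \<nu> A"
  shows "conditional_cdf \<rho> y (\<lambda>x. (1 - e) * g x + e * h x)"
  unfolding conditional_cdf_def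
proof (intro conjI ballI)
  have gh: "integrable unit_lborel g" "integrable unit_lborel h"
    using assms by (auto simp: conditional_cdf_def)
  then show "integrable unit_lborel (\<lambda>x. (1 - e) * g x + e * h x)" by simp
  fix A assume A: "A \<in> sets unit_lborel"
  have "A \<times> {0..y} \<in> sets unit_square_borel"
    unfolding sets_unit_square_borel using A assms(3) by auto
  then have "measure \<rho> (A \<times> {0..y}) =
      (1 - e) * (\<integral>x. g x * indicator A x \<partial>unit_lborel) + e * (\<integral>x. h x * indicator A x \<partial>unit_lborel)"
    using assms(1,2) A by (simp add: mix conditional_cdf_def)
  also have "\<dots> = (\<integral>x. (1 - e) * (g x * indicator A x) + e * (h x * indicator A x) \<partial>unit_lborel)"
    using integrable_real_mult_indicator[OF A gh(1)] integrable_real_mult_indicator[OF A gh(2)] by simp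
  also have "\<dots> = (\<integral>x. ((1 - e) * g x + e * h x) * indicator A x \<partial>unit_lborel)"
    by (rule Bochner_Integration.integral_cong) (auto simp: algebra_simps)
  finally show "measure \<rho> (A \<times> {0..y}) = (\<integral>x. ((1 - e) * g x + e * h x) * indicator A x \<partial>unit_lborel)" .
qed

text \<open>
  The mixtures of \<open>C\<close> with the oscillating measures, with weight \<open>e\<close> on the latter. Conditional
  distribution functions are affine in the measure, so all distances between them scale with
  \<open>e\<close>: the mixtures are within \<open>2 * e\<close> of \<open>C\<close>. For two of them the contribution of \<open>C\<close>
  cancels; at height \<open>y\<close> there remains \<open>e / (2 * pi) * \<bar>sin (2 * pi * y)\<bar>\<close> times the
  \<open>L\<^sup>1\<close> distance of two waves, which is at least 1/2. Estimating \<open>\<bar>sin\<bar>\<close> from below by the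
  square of the sine, which has mean 1/2, gives the lower bound \<open>e / (8 * pi)\<close>.
\<close>

lemma separated_perturbations:
  assumes C: "C \<in> copulas" and e: "0 < e" "e \<le> 1"
  obtains B where "\<And>k. 0 < k \<Longrightarrow> B k \<in> copulas" "\<And>k. 0 < k \<Longrightarrow> D1 C (B k) \<le> 2 * e"
    "\<And>k l. 0 < k \<Longrightarrow> 0 < l \<Longrightarrow> k \<noteq> (l :: int) \<Longrightarrow> e / (8 * pi) \<le> D1 (B k) (B l)"
proof -
  obtain \<mu> where \<mu>: "doubly_stochastic \<mu>" and C_def: "C = copula_of \<mu>" using C by (auto simp: copulas_def)
  have "\<exists>\<rho>. 0 < k \<longrightarrow> doubly_stochastic \<rho> \<and>
     (\<forall>A\<in>sets unit_square_borel. measure \<rho> A = (1 - e) * measure \<mu> A + e * measure (wave_measure k) A)" for k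
    using doubly_stochastic_mixture[OF \<mu> doubly_stochastic_wave_measure[of k], of e] e by fastforce
  then obtain \<rho> where \<rho>: "\<And>k. 0 < k \<Longrightarrow> doubly_stochastic (\<rho> k)"
    and mix: "\<And>k A. 0 < k \<Longrightarrow> A \<in> sets unit_square_borel \<Longrightarrow>
        measure (\<rho> k) A = (1 - e) * measure \<mu> A + e * measure (wave_measure k) A"
    by metis
  define g where "g k y x = y + wave k x * (sin (2 * pi * y) / (2 * pi))" for k y x
  define F where "F y = kernel_cdf C y" for y
  have F: "conditional_cdf \<mu> y (F y)" if "y \<in> {0..1}" for y
    unfolding F_def C_def using \<mu> that by (intro conditional_cdf_kernel_cdf) auto
  have cond: "conditional_cdf (\<rho> k) y (\<lambda>x. (1 - e) * F y x + e * g k y x)" if "0 < k" "y \<in> {0..1}" for k y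
    using that conditional_cdf_wave_measure[of k y] mix
    by (intro conditional_cdf_mixture[OF F]) (auto simp: g_def)
  have cop: "copula_of (\<rho> k) \<in> copulas" if "0 < k" for k using \<rho>[OF that] by (simp add: copulas_def)
  show ?thesis
  proof (rule that[of "\<lambda>k. copula_of (\<rho> k)"])
    fix k :: int assume k: "0 < k"
    have "section_dist C (copula_of (\<rho> k)) y \<le> 2 * e" if y: "y \<in> {0..1}" for y
    proof -
      have "section_dist C (copula_of (\<rho> k)) y = (LINT x|unit_lborel. \<bar>F y x - ((1 - e) * F y x + e * g k y x)\<bar>)"
        unfolding C_def using y by (intro section_dist_conditional_cdf \<mu> \<rho> k F cond) auto
      also have "\<dots> \<le> (LINT x|unit_lborel. 2 * e)"
      proof (rule integral_mono)
        show "integrable unit_lborel (\<lambda>x. \<bar>F y x - ((1 - e) * F y x + e * g k y x)\<bar>)"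
          using F[OF y] cond[OF k y] unfolding conditional_cdf_def
          by (intro integrable_abs Bochner_Integration.integrable_diff) auto
        fix x assume "x \<in> space unit_lborel"
        then have x: "x \<in> {0..1}" by simp
        have "\<bar>wave k x * sin (2 * pi * y)\<bar> \<le> 1"
          by (simp only: abs_mult) (rule mult_le_one, auto simp: abs_wave_le_1)
        then have "\<bar>wave k x * (sin (2 * pi * y) / (2 * pi))\<bar> \<le> 1"
          using pi_ge_two by (simp add: abs_mult field_simps)
        moreover have "\<bar>F y x - y\<bar> \<le> 1"
          using kernel_cdf_le_1[OF C x, of y] measure_nonneg[of "copula_kernel C x" "{0..y}"] y
          unfolding F_def atLeastAtMost_iff by linarith
        ultimately have "\<bar>F y x - g k y x\<bar> \<le> 2" unfolding g_def by linarith
        moreover have "\<bar>F y x - ((1 - e) * F y x + e * g k y x)\<bar> = e * \<bar>F y x - g k y x\<bar>"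
        proof -
          have "F y x - ((1 - e) * F y x + e * g k y x) = e * (F y x - g k y x)"
            by (simp add: algebra_simps)
          then show ?thesis using e by (simp add: abs_mult)
        qed
        ultimately show "\<bar>F y x - ((1 - e) * F y x + e * g k y x)\<bar> \<le> 2 * e"
          using e by simp
      qed simp
      finally show ?thesis by simp
    qed
    then have "D1 C (copula_of (\<rho> k)) \<le> (LINT y|unit_lborel. 2 * e)"
      unfolding D1_eq_section_dist using integrable_section_dist[OF C cop[OF k]]
      by (intro integral_mono) auto
    then show "D1 C (copula_of (\<rho> k)) \<le> 2 * e" by simp
  next
    fix k l :: int assume k: "0 < k" and l: "0 < l" and kl: "k \<noteq> l"
    have sin_sq: "(sin (2 * pi * y))\<^sup>2 = 1 / 2 - wave 2 y / 2" for y
      using cos_double_sin[of "2 * pi * y"] by (simp add: wave_def algebra_simps)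
    have "e / (4 * pi) * (sin (2 * pi * y))\<^sup>2 \<le> section_dist (copula_of (\<rho> k)) (copula_of (\<rho> l)) y"
      if y: "y \<in> {0..1}" for y
    proof -
      let ?s = "\<bar>sin (2 * pi * y)\<bar>"
      have "section_dist (copula_of (\<rho> k)) (copula_of (\<rho> l)) y =
        (LINT x|unit_lborel. \<bar>((1 - e) * F y x + e * g k y x) - ((1 - e) * F y x + e * g l y x)\<bar>)"
        using y by (intro section_dist_conditional_cdf \<rho> k l cond) auto
      also have "\<dots> = (LINT x|unit_lborel. (e / (2 * pi) * ?s) * \<bar>wave k x - wave l x\<bar>)"
      proof (rule Bochner_Integration.integral_cong[OF refl])
        fix x
        have "((1 - e) * F y x + e * g k y x) - ((1 - e) * F y x + e * g l y x) =
            e / (2 * pi) * sin (2 * pi * y) * (wave k x - wave l x)"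
          by (simp add: g_def field_simps)
        then show "\<bar>((1 - e) * F y x + e * g k y x) - ((1 - e) * F y x + e * g l y x)\<bar> =
            (e / (2 * pi) * ?s) * \<bar>wave k x - wave l x\<bar>"
          using e by (simp add: abs_mult)
      qed
      also have "\<dots> = (e / (2 * pi) * ?s) * (LINT x|unit_lborel. \<bar>wave k x - wave l x\<bar>)"
        by simp
      finally have eq: "section_dist (copula_of (\<rho> k)) (copula_of (\<rho> l)) y =
        (e / (2 * pi) * ?s) * (LINT x|unit_lborel. \<bar>wave k x - wave l x\<bar>)" .
      have "?s * ?s \<le> ?s * 1" by (rule mult_left_mono) auto
      then have "(sin (2 * pi * y))\<^sup>2 \<le> ?s" by (simp add: power2_eq_square flip: abs_mult)
      then have "e / (4 * pi) * (sin (2 * pi * y))\<^sup>2 \<le> e / (4 * pi) * ?s"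
        using e by (intro mult_left_mono) auto
      also have "\<dots> = (e / (2 * pi) * ?s) * (1 / 2)" by simp
      also have "\<dots> \<le> (e / (2 * pi) * ?s) * (LINT x|unit_lborel. \<bar>wave k x - wave l x\<bar>)"
        using wave_L1_separated[OF k l kl] e by (intro mult_left_mono) auto
      finally show ?thesis unfolding eq .
    qed
    then have "(LINT y|unit_lborel. e / (4 * pi) * (1 / 2 - wave 2 y / 2)) \<le> D1 (copula_of (\<rho> k)) (copula_of (\<rho> l))"
      unfolding D1_eq_section_dist sin_sq
      using integrable_section_dist[OF cop[OF k] cop[OF l]] integrable_wave[of 2]
      by (intro integral_mono) auto
    moreover have "(LINT y|unit_lborel. e / (4 * pi) * (1 / 2 - wave 2 y / 2)) = e / (8 * pi)"
      using integrable_wave[of 2] integral_wave[of 2] by simp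
    ultimately show "e / (8 * pi) \<le> D1 (copula_of (\<rho> k)) (copula_of (\<rho> l))" by simp
  qed (rule cop)
qed

lemma (in Metric_space) not_compactin_if_separated_sequence:
  fixes \<sigma> :: "nat \<Rightarrow> 'a"
  assumes "range \<sigma> \<subseteq> S" "0 < \<delta>" "\<And>m n. m \<noteq> n \<Longrightarrow> \<delta> \<le> d (\<sigma> m) (\<sigma> n)"
  shows "\<not> compactin mtopology S"
proof
  assume "compactin mtopology S"
  then obtain l r where r: "strict_mono r" and lim: "limitin mtopology (\<sigma> \<circ> r) l sequentially"
    and S: "S \<subseteq> M"
    using assms(1) unfolding compactin_sequentially by blast
  have l: "l \<in> M" and ev: "\<forall>\<^sub>F n in sequentially. (\<sigma> \<circ> r) n \<in> M \<and> d ((\<sigma> \<circ> r) n) l < \<delta> / 2"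
    using lim half_gt_zero[OF \<open>0 < \<delta>\<close>] unfolding limitin_metric by blast+
  then obtain n where n: "\<And>m. n \<le> m \<Longrightarrow> \<sigma> (r m) \<in> M \<and> d (\<sigma> (r m)) l < \<delta> / 2"
    unfolding eventually_sequentially by auto
  have "d (\<sigma> (r n)) (\<sigma> (r (Suc n))) \<le> d (\<sigma> (r n)) l + d l (\<sigma> (r (Suc n)))"
    using n[of n] n[of "Suc n"] l by (intro triangle) auto
  also have "\<dots> < \<delta>" using n[of n] n[of "Suc n"] commute[of l] by simp
  also have "\<delta> \<le> d (\<sigma> (r n)) (\<sigma> (r (Suc n)))"
    using strict_mono_eq[OF r, of n "Suc n"] by (intro assms) auto
  finally show False by simp
qed

interpretation D1: Metric_space copulas D1
  by (rule Metric_space_D1)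

text \<open>
  Stated for sets containing a ball, so that it covers both compact balls and compact neighbourhoods.
\<close>

lemma not_compactin_if_contains_ball:
  assumes C: "C \<in> copulas" and r: "0 < r" and S: "D1.mcball C r \<subseteq> S"
  shows "\<not> compactin D1.mtopology S"
proof -
  \<comment> \<open>Mixtures of weight \<open>e\<close> stay within distance \<open>2 * e\<close> of \<open>C\<close>.\<close>
  define e where "e = min 1 (r / 2)"
  have e: "0 < e" "e \<le> 1" "2 * e \<le> r" using r by (auto simp: e_def)
  obtain B where B: "\<And>k. 0 < k \<Longrightarrow> B k \<in> copulas" "\<And>k. 0 < k \<Longrightarrow> D1 C (B k) \<le> 2 * e"
    "\<And>k l. 0 < k \<Longrightarrow> 0 < l \<Longrightarrow> k \<noteq> (l :: int) \<Longrightarrow> e / (8 * pi) \<le> D1 (B k) (B l)"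
    using separated_perturbations[OF C e(1,2)] by blast
  show ?thesis
  proof (rule D1.not_compactin_if_separated_sequence)
    show "range (\<lambda>n. B (int n + 1)) \<subseteq> S"
    proof (intro order_trans[OF _ S] image_subsetI)
      fix n
      show "B (int n + 1) \<in> D1.mcball C r"
        using B(1,2)[of "int n + 1"] C e by simp
    qed
    show "0 < e / (8 * pi)" using e by simp
    show "e / (8 * pi) \<le> D1 (B (int m + 1)) (B (int n + 1))" if "m \<noteq> n" for m n
      using that by (intro B(3)) auto
  qed
qed

theorem corollary3p3:
  shows "(\<forall>C \<in> copulas. \<forall>r > 0.
            \<not> compactin (Metric_space.mtopology copulas D1) (Metric_space.mcball copulas D1 C r))
         \<and> nowhere_locally_compact_space (Metric_space.mtopology copulas D1)"
proof (intro conjI ballI allI impI)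
  fix C and r :: real assume "C \<in> copulas" "0 < r"
  then show "\<not> compactin D1.mtopology (D1.mcball C r)"
    by (rule not_compactin_if_contains_ball) simp
next
  show "nowhere_locally_compact_space D1.mtopology"
    unfolding nowhere_locally_compact_space_def
  proof (intro ballI notI, elim exE conjE)
    fix C U K assume "openin D1.mtopology U" "C \<in> U" "U \<subseteq> K" and K: "compactin D1.mtopology K"
    then obtain r where "C \<in> copulas" "0 < r" "D1.mcball C r \<subseteq> K"
      unfolding D1.openin_mtopology_mcball by blast
    with K show False using not_compactin_if_contains_ball by blast
  qed
qed

end
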